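(* Let $n=p+q\ge5$, $r=p+\binom{q}{2}$ and $s=q+\binom{p}{2}$. Let $\mathrm{K}_n$ have nodes $\mathrm{A}_1,\dots,\mathrm{A}_p,\mathrm{B}_1,\dots,\mathrm{B}_q$, and let $\mathrm{K}_{r,s}$ be the complete bipartite graph with sides $\{\mathrm{A}_i\mid 1\le i\le p\}\cup\{\mathrm{A}_{jj'}\mid 1\le j<j'\le q\}$ and $\{\mathrm{B}_j\mid 1\le j\le q\}\cup\{\mathrm{B}_{ii'}\mid 1\le i<i'\le p\}$, regarded as a triangular elimination of $\mathrm{K}_n$ with respect to $F=\{\mathrm{A}_i\mathrm{A}_{i'}\}\cup\{\mathrm{B}_j\mathrm{B}_{j'}\}$ with node $\mathrm{B}_{ii'}$ associated with edge $\mathrm{A}_i\mathrm{A}_{i'}$ and node $\mathrm{A}_{jj'}$ associated with edge $\mathrm{B}_j\mathrm{B}_{j'}$. Let $\bm{a}^{\mathrm{T}}\bm{x}\le a_0$ and $\bm{b}^{\mathrm{T}}\bm{x}\le b_0$ be facet inducing inequalities of $\mathrm{CUT}^\square(\mathrm{K}_n)$ that are not triangle inequalities, and let $(\bm{a}')^{\mathrm{T}}\bm{x}\le a'_0$ and $(\bm{b}')^{\mathrm{T}}\bm{x}\le b'_0$ be respective triangular eliminations of them to $\mathrm{CUT}^\square(\mathrm{K}_{r,s})$. Then the following are equivalent: (a) $\bm{a}^{\mathrm{T}}\bm{x}\le a_0$ and $\bm{b}^{\mathrm{T}}\bm{x}\le b_0$ can be transformed into each other by some combination of switching operations, permutations of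 nodes within $\{\mathrm{A}_1,\dots,\mathrm{A}_p\}$ or within $\{\mathrm{B}_1,\dots,\mathrm{B}_q\}$, and, if $p=q$, the permutation swapping $\mathrm{A}_i$ and $\mathrm{B}_i$ simultaneously for all $i$; (b) $(\bm{a}')^{\mathrm{T}}\bm{x}\le a'_0$ and $(\bm{b}')^{\mathrm{T}}\bm{x}\le b'_0$ are permutation-switching equivalent (in $\mathrm{K}_{r,s}$).
   Context: For a graph $G=(V,E)$ and $S\subseteq V$, the cut vector $\bm{\delta}_G(S)\in\mathbb{R}^E$ has $uv$-coordinate $\delta_{uv}(S)=1$ if $|S\cap\{u,v\}|=1$ and $0$ otherwise; $\mathrm{CUT}^\square(G)$ is the convex hull of all cut vectors. Facet inducing means valid with the induced face a facet. Coordinates are indexed by unordered pairs, $x_{uv}=x_{vu}$. For $S\subseteq V$, the $S$-switching of $\bm{a}^{\mathrm{T}}\bm{x}\le a_0$ is $(\bm{c})^{\mathrm{T}}\bm{x}\le a_0-\bm{a}^{\mathrm{T}}\bm{\delta}_G(S)$ with $c_{ij}=(-1)^{\delta_{ij}(S)}a_{ij}$. For a permutation $\sigma$ of $V$ that is an automorphism of $G$, the $\sigma$-permutation of $\bm{a}^{\mathrm{T}}\bm{x}\le a_0$ is $\bm{c}^{\mathrm{T}}\bm{x}\le a_0$ with $c_{ij}=a_{\sigma(i)\sigma(j)}$. Two inequalities are permutation-switching equivalent if they can be transformed into each other by a sequence of permutations and switchings. For nodes $u,v,w$ define the triangular forms $\Delta(u,v;w)=x_{uv}-x_{uw}-x_{vw}$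 and $\Delta(u,v,w)=x_{uv}+x_{uw}+x_{vw}-2$; $\Delta\{u,v,w\}$ denotes any one of $\Delta(u,v;w)$, $\Delta(w,v;u)$, $\Delta(u,w;v)$, $\Delta(u,v,w)$. A triangle inequality is one of the form $\lambda\Delta\{u,v,w\}\le0$ with $\lambda>0$ and $u,v,w$ distinct nodes. If $G'=(V',E')$ is obtained from $G=(V,E)$ by adding nodes $w_1,\dots,w_t$, with $w_i$ associated with edge $u_iv_i\in E$, where $E'\supseteq\{w_iu_i,w_iv_i\}$ and $E'\cap E=E\setminus\{u_1v_1,\dots,u_tv_t\}$, then $(\bm{a}')^{\mathrm{T}}\bm{x}\le a'_0$ ($\bm a'\in\mathbb{R}^{E'}$) is a triangular elimination of $\bm{a}^{\mathrm{T}}\bm{x}\le a_0$ ($\bm a\in\mathbb{R}^E$) if for some choices of triangular forms $\Delta_i\{u_i,v_i,w_i\}$ one has the identity of affine functions $(\bm{a}')^{\mathrm{T}}\bm{x}-a'_0=\bm{a}^{\mathrm{T}}\bm{x}-a_0+\sum_{i=1}^t|a_{u_iv_i}|\,\Delta_i\{u_i,v_i,w_i\}$. *)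

theory Defs
  imports "HOL-Analysis.Analysis" "HOL-Combinatorics.Permutations"
begin

section \<open>Graphs, edge vectors and cut polytopes\<close>

text \<open>
  A graph is a pair (V, E) whose edges are two-element sets of nodes.  To be able to use the
  library notions for Euclidean spaces (\<^const>\<open>inner\<close>, \<^const>\<open>aff_dim\<close>, \<^const>\<open>facet_of\<close>) for
  all graphs on nodes of a finite type, the space of vectors indexed by E is realised as the
  coordinate subspace \<open>edge_space G\<close> of the vectors indexed by all sets of nodes.
\<close>

type_synonym 'v graph = "'v set \<times> 'v set set"
type_synonym 'v evec = "(real, 'v set) vec"
type_synonym 'v ineq = "'v evec \<times> real"

abbreviation verts :: "'v graph \<Rightarrow> 'v set" where "verts G \<equiv> fst G"
abbreviation edges :: "'v graph \<Rightarrow> 'v set set" where "edges G \<equiv> snd G"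

definition complete_graph :: "'v set \<Rightarrow> 'v graph" where
  "complete_graph V = (V, {{u, v} |u v. u \<in> V \<and> v \<in> V \<and> u \<noteq> v})"

definition complete_bipartite :: "'v set \<Rightarrow> 'v set \<Rightarrow> 'v graph" where
  "complete_bipartite X Y = (X \<union> Y, {{x, y} |x y. x \<in> X \<and> y \<in> Y})"

definition edge_space :: "'v::finite graph \<Rightarrow> 'v evec set" where
  "edge_space G = {x. \<forall>e. e \<notin> edges G \<longrightarrow> x $ e = 0}"

definition cut_vec :: "'v::finite graph \<Rightarrow> 'v set \<Rightarrow> 'v evec" where
  "cut_vec G S = (\<chi> e. if e \<in> edges G \<and> card (S \<inter> e) = 1 then 1 else 0)"

definition cut_polytope :: "'v::finite graph \<Rightarrow> 'v evec set" where
  "cut_polytope G = convex hull {cut_vec G S |S. S \<subseteq> verts G}"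

text \<open>The pair (a, a0) stands for the inequality \<open>a \<bullet> x \<le> a0\<close>; inequalities are compared by
  their coefficients, that is, not up to positive scaling.\<close>

definition facet_inducing :: "'v::finite graph \<Rightarrow> 'v ineq \<Rightarrow> bool" where
  "facet_inducing G = (\<lambda>(a, a0). a \<in> edge_space G \<and>
     (\<forall>x\<in>cut_polytope G. a \<bullet> x \<le> a0) \<and>
     {x \<in> cut_polytope G. a \<bullet> x = a0} facet_of cut_polytope G)"


section \<open>Switchings and permutations\<close>

definition switching :: "'v::finite graph \<Rightarrow> 'v set \<Rightarrow> 'v ineq \<Rightarrow> 'v ineq" where
  "switching G S = (\<lambda>(a, a0).
     (\<chi> e. if card (S \<inter> e) = 1 then - (a $ e) else a $ e, a0 - a \<bullet> cut_vec G S))"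

definition permutation_of :: "('v::finite \<Rightarrow> 'v) \<Rightarrow> 'v ineq \<Rightarrow> 'v ineq" where
  "permutation_of \<sigma> = (\<lambda>(a, a0). (\<chi> e. a $ (\<sigma> ` e), a0))"

definition automorphisms :: "'v graph \<Rightarrow> ('v \<Rightarrow> 'v) set" where
  "automorphisms G = {\<sigma>. \<sigma> permutes verts G \<and>
     (\<forall>u\<in>verts G. \<forall>v\<in>verts G. {u, v} \<in> edges G \<longleftrightarrow> {\<sigma> u, \<sigma> v} \<in> edges G)}"

inductive ps_step :: "'v::finite graph \<Rightarrow> ('v \<Rightarrow> 'v) set \<Rightarrow> 'v ineq \<Rightarrow> 'v ineq \<Rightarrow> bool"
  for G :: "'v graph" and P :: "('v \<Rightarrow> 'v) set" where
  switch: "S \<subseteq> verts G \<Longrightarrow> ps_step G P I (switching G S I)"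
| permute: "\<sigma> \<in> P \<Longrightarrow> ps_step G P I (permutation_of \<sigma> I)"

definition transformable :: "'v::finite graph \<Rightarrow> ('v \<Rightarrow> 'v) set \<Rightarrow> 'v ineq \<Rightarrow> 'v ineq \<Rightarrow> bool" where
  "transformable G P I J \<longleftrightarrow> (ps_step G P)\<^sup>*\<^sup>* I J \<and> (ps_step G P)\<^sup>*\<^sup>* J I"

definition ps_equivalent :: "'v::finite graph \<Rightarrow> 'v ineq \<Rightarrow> 'v ineq \<Rightarrow> bool" where
  "ps_equivalent G = transformable G (automorphisms G)"


section \<open>Triangular elimination\<close>

definition tri_minus :: "'v::finite \<Rightarrow> 'v \<Rightarrow> 'v \<Rightarrow> 'v evec \<Rightarrow> real" where
  "tri_minus u v w x = x $ {u, v} - x $ {u, w} - x $ {v, w}"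

definition tri_plus :: "'v::finite \<Rightarrow> 'v \<Rightarrow> 'v \<Rightarrow> 'v evec \<Rightarrow> real" where
  "tri_plus u v w x = x $ {u, v} + x $ {u, w} + x $ {v, w} - 2"

definition tri_forms :: "'v::finite \<Rightarrow> 'v \<Rightarrow> 'v \<Rightarrow> ('v evec \<Rightarrow> real) set" where
  "tri_forms u v w = {tri_minus u v w, tri_minus w v u, tri_minus u w v, tri_plus u v w}"

definition triangle_inequality :: "'v::finite graph \<Rightarrow> 'v ineq \<Rightarrow> bool" where
  "triangle_inequality G = (\<lambda>(a, a0). \<exists>u\<in>verts G. \<exists>v\<in>verts G. \<exists>w\<in>verts G.
     u \<noteq> v \<and> u \<noteq> w \<and> v \<noteq> w \<and>
     (\<exists>l>0. \<exists>\<Delta>\<in>tri_forms u v w. \<forall>x. a \<bullet> x - a0 = l * \<Delta> x))"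

text \<open>A triple (u, v, w) in T records that the new node w is associated with the edge uv.\<close>

definition graph_tri_elim ::
    "'v graph \<Rightarrow> ('v \<times> 'v \<times> 'v) set \<Rightarrow> 'v graph \<Rightarrow> bool" where
  "graph_tri_elim G T G' \<longleftrightarrow>
     (\<forall>(u, v, w)\<in>T. {u, v} \<in> edges G \<and> w \<notin> verts G \<and> {w, u} \<in> edges G' \<and> {w, v} \<in> edges G') \<and>
     inj_on (\<lambda>(u, v, w). w) T \<and>
     verts G' = verts G \<union> (\<lambda>(u, v, w). w) ` T \<and>
     edges G' \<inter> edges G = edges G - (\<lambda>(u, v, w). {u, v}) ` T"

definition tri_elim ::
    "'v::finite graph \<Rightarrow> ('v \<times> 'v \<times> 'v) set \<Rightarrow> 'v graph \<Rightarrow> 'v ineq \<Rightarrow> 'v ineq \<Rightarrow> bool" where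
  "tri_elim G T G' = (\<lambda>(a, a0) (a', a0').
     graph_tri_elim G T G' \<and> a \<in> edge_space G \<and> a' \<in> edge_space G' \<and>
     (\<exists>\<Delta>. (\<forall>(u, v, w)\<in>T. \<Delta> (u, v, w) \<in> tri_forms u v w) \<and>
       (\<forall>x. a' \<bullet> x - a0' =
            a \<bullet> x - a0 + (\<Sum>(u, v, w)\<in>T. \<bar>a $ {u, v}\<bar> * \<Delta> (u, v, w) x))))"


section \<open>The complete bipartite graph as a triangular elimination of the complete graph\<close>

text \<open>
  \<open>NAA j j'\<close> is the node on the A-side associated with the edge between \<open>NB j\<close> and \<open>NB j'\<close>, and
  \<open>NBB i i'\<close> the node on the B-side associated with the edge between \<open>NA i\<close> and \<open>NA i'\<close>.  Since
  the type of labels is infinite, the nodes of the graphs are the images of the labels under a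
  map \<open>\<nu>\<close> into a finite type, injective on the labels used.
\<close>

datatype label = NA nat | NB nat | NAA nat nat | NBB nat nat

definition A_nodes :: "nat \<Rightarrow> label set" where "A_nodes p = NA ` {1..p}"
definition B_nodes :: "nat \<Rightarrow> label set" where "B_nodes q = NB ` {1..q}"

definition A_side :: "nat \<Rightarrow> nat \<Rightarrow> label set" where
  "A_side p q = A_nodes p \<union> {NAA j j' |j j'. 1 \<le> j \<and> j < j' \<and> j' \<le> q}"

definition B_side :: "nat \<Rightarrow> nat \<Rightarrow> label set" where
  "B_side p q = B_nodes q \<union> {NBB i i' |i i'. 1 \<le> i \<and> i < i' \<and> i' \<le> p}"

definition K :: "(label \<Rightarrow> 'v) \<Rightarrow> nat \<Rightarrow> nat \<Rightarrow> 'v graph" where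
  "K \<nu> p q = complete_graph (\<nu> ` (A_nodes p \<union> B_nodes q))"

definition Kbip :: "(label \<Rightarrow> 'v) \<Rightarrow> nat \<Rightarrow> nat \<Rightarrow> 'v graph" where
  "Kbip \<nu> p q = complete_bipartite (\<nu> ` A_side p q) (\<nu> ` B_side p q)"

definition elim_triples :: "(label \<Rightarrow> 'v) \<Rightarrow> nat \<Rightarrow> nat \<Rightarrow> ('v \<times> 'v \<times> 'v) set" where
  "elim_triples \<nu> p q =
     {(\<nu> (NA i), \<nu> (NA i'), \<nu> (NBB i i')) |i i'. 1 \<le> i \<and> i < i' \<and> i' \<le> p} \<union>
     {(\<nu> (NB j), \<nu> (NB j'), \<nu> (NAA j j')) |j j'. 1 \<le> j \<and> j < j' \<and> j' \<le> q}"

definition AB_permutations :: "(label \<Rightarrow> 'v) \<Rightarrow> nat \<Rightarrow> nat \<Rightarrow> ('v \<Rightarrow> 'v) set" where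
  "AB_permutations \<nu> p q =
     {\<sigma>. \<sigma> permutes \<nu> ` A_nodes p} \<union> {\<sigma>. \<sigma> permutes \<nu> ` B_nodes q} \<union>
     {\<sigma>. p = q \<and> \<sigma> permutes \<nu> ` (A_nodes p \<union> B_nodes q) \<and>
        (\<forall>i\<in>{1..p}. \<sigma> (\<nu> (NA i)) = \<nu> (NB i) \<and> \<sigma> (\<nu> (NB i)) = \<nu> (NA i))}"


subsection \<open>Sanity checks\<close>

lemma card_pairs: "card {(i, j) |i j :: nat. 1 \<le> i \<and> i < j \<and> j \<le> n} = n choose 2"
  (is "card (?S n) = _")
proof (induction n)
  case 0
  have "?S 0 = {}" by auto
  then show ?case by simp
next
  case (Suc n)
  have eq: "?S (Suc n) = ?S n \<union> (\<lambda>i. (i, Suc n)) ` {1..n}" by (auto simp: le_Suc_eq)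
  have "finite (?S n)" by (rule finite_subset[of _ "{1..n} \<times> {1..n}"]) auto
  moreover have "?S n \<inter> (\<lambda>i. (i, Suc n)) ` {1..n} = {}" by auto
  moreover have "card ((\<lambda>i. (i, Suc n)) ` {1..n}) = n" by (simp add: card_image inj_on_def)
  ultimately have "card (?S (Suc n)) = (n choose 2) + n"
    unfolding eq using Suc by (subst card_Un_disjoint) auto
  then show ?case by (simp add: numeral_2_eq_2)
qed

lemma card_A_side: "card (A_side p q) = p + (q choose 2)"
proof -
  have im: "{NAA j j' |j j'. 1 \<le> j \<and> j < j' \<and> j' \<le> q} =
      (\<lambda>(j, j'). NAA j j') ` {(i, j) |i j. 1 \<le> i \<and> i < j \<and> j \<le> q}" (is "?L = ?f ` ?S") by auto
  have fin: "finite ?S" by (rule finite_subset[of _ "{1..q} \<times> {1..q}"]) auto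
  have "card ?L = q choose 2"
    unfolding im card_pairs[symmetric] by (rule card_image) (auto simp: inj_on_def)
  moreover have "card (A_nodes p) = p" by (simp add: A_nodes_def card_image inj_on_def)
  moreover have "finite ?L" using fin unfolding im by simp
  moreover have "finite (A_nodes p)" "A_nodes p \<inter> ?L = {}" by (auto simp: A_nodes_def)
  ultimately show ?thesis unfolding A_side_def by (subst card_Un_disjoint) auto
qed

lemma card_B_side: "card (B_side p q) = q + (p choose 2)"
proof -
  have im: "{NBB j j' |j j'. 1 \<le> j \<and> j < j' \<and> j' \<le> p} =
      (\<lambda>(j, j'). NBB j j') ` {(i, j) |i j. 1 \<le> i \<and> i < j \<and> j \<le> p}" (is "?L = ?f ` ?S") by auto
  have fin: "finite ?S" by (rule finite_subset[of _ "{1..p} \<times> {1..p}"]) auto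
  have "card ?L = p choose 2"
    unfolding im card_pairs[symmetric] by (rule card_image) (auto simp: inj_on_def)
  moreover have "card (B_nodes q) = q" by (simp add: B_nodes_def card_image inj_on_def)
  moreover have "finite ?L" using fin unfolding im by simp
  moreover have "finite (B_nodes q)" "B_nodes q \<inter> ?L = {}" by (auto simp: B_nodes_def)
  ultimately show ?thesis unfolding B_side_def by (subst card_Un_disjoint) auto
qed

lemma graph_tri_elim_Kbip:
  assumes inj: "inj_on \<nu> (A_side p q \<union> B_side p q)"
  shows "graph_tri_elim (K \<nu> p q) (elim_triples \<nu> p q) (Kbip \<nu> p q)"
proof -
  let ?N = "A_side p q \<union> B_side p q"
  let ?T = "elim_triples \<nu> p q"
  have eq: "\<nu> x = \<nu> y \<longleftrightarrow> x = y" if "x \<in> ?N" "y \<in> ?N" for x y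
    using inj that by (auto simp: inj_on_def)
  have T: "\<exists>x y z. t = (\<nu> x, \<nu> y, \<nu> z) \<and> x \<noteq> y \<and>
      x \<in> A_nodes p \<union> B_nodes q \<and> y \<in> A_nodes p \<union> B_nodes q \<and> z \<in> ?N \<and>
      z \<notin> A_nodes p \<union> B_nodes q \<and>
      (x \<in> A_side p q \<and> y \<in> A_side p q \<and> z \<in> B_side p q \<or>
       x \<in> B_side p q \<and> y \<in> B_side p q \<and> z \<in> A_side p q)" if "t \<in> ?T" for t
    using that unfolding elim_triples_def
    by (fastforce simp: A_side_def B_side_def A_nodes_def B_nodes_def)
  have sub: "A_nodes p \<union> B_nodes q \<subseteq> ?N" by (auto simp: A_side_def B_side_def)
  have "\<forall>(u, v, w)\<in>?T. {u, v} \<in> edges (K \<nu> p q) \<and> w \<notin> verts (K \<nu> p q) \<and>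
      {w, u} \<in> edges (Kbip \<nu> p q) \<and> {w, v} \<in> edges (Kbip \<nu> p q)"
  proof (intro ballI)
    fix t assume "t \<in> ?T"
    from T[OF this] obtain x y z where t: "t = (\<nu> x, \<nu> y, \<nu> z)" and xy: "x \<noteq> y"
      "x \<in> A_nodes p \<union> B_nodes q" "y \<in> A_nodes p \<union> B_nodes q"
      and z: "z \<in> ?N" "z \<notin> A_nodes p \<union> B_nodes q"
      and s: "x \<in> A_side p q \<and> y \<in> A_side p q \<and> z \<in> B_side p q \<or>
       x \<in> B_side p q \<and> y \<in> B_side p q \<and> z \<in> A_side p q" by blast
    have "\<nu> x \<noteq> \<nu> y" using xy sub eq by blast
    then have 1: "{\<nu> x, \<nu> y} \<in> edges (K \<nu> p q)"
      using xy unfolding K_def complete_graph_def snd_conv by blast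
    have 2: "\<nu> z \<notin> verts (K \<nu> p q)"
      using z sub eq unfolding K_def complete_graph_def fst_conv by blast
    have "{\<nu> z, \<nu> x} \<in> edges (Kbip \<nu> p q) \<and> {\<nu> z, \<nu> y} \<in> edges (Kbip \<nu> p q)"
      using s unfolding Kbip_def complete_bipartite_def snd_conv by blast
    with 1 2 show "case t of (u, v, w) \<Rightarrow> {u, v} \<in> edges (K \<nu> p q) \<and>
      w \<notin> verts (K \<nu> p q) \<and> {w, u} \<in> edges (Kbip \<nu> p q) \<and> {w, v} \<in> edges (Kbip \<nu> p q)"
      by (simp add: t)
  qed
  moreover have "inj_on (\<lambda>(u, v, w). w) ?T"
  proof (rule inj_onI)
    fix t t' assume t: "t \<in> ?T" "t' \<in> ?T" and e: "(\<lambda>(u, v, w). w) t = (\<lambda>(u, v, w). w) t'"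
    define f where "f = (\<lambda>l. case l of NBB i i' \<Rightarrow> (\<nu> (NA i), \<nu> (NA i'), \<nu> l)
      | NAA j j' \<Rightarrow> (\<nu> (NB j), \<nu> (NB j'), \<nu> l) | _ \<Rightarrow> undefined)"
    have f: "\<exists>l\<in>?N. t = f l \<and> (\<lambda>(u, v, w). w) t = \<nu> l" if "t \<in> ?T" for t
      using that unfolding elim_triples_def
    proof (elim UnE)
      assume "t \<in> {(\<nu> (NA i), \<nu> (NA i'), \<nu> (NBB i i')) |i i'. 1 \<le> i \<and> i < i' \<and> i' \<le> p}"
      then obtain i i' where *: "t = (\<nu> (NA i), \<nu> (NA i'), \<nu> (NBB i i'))" "1 \<le> i" "i < i'" "i' \<le> p"
        by blast
      show ?thesis
        by (rule bexI[of _ "NBB i i'"]) (use * in \<open>simp_all add: f_def B_side_def\<close>)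
    next
      assume "t \<in> {(\<nu> (NB j), \<nu> (NB j'), \<nu> (NAA j j')) |j j'. 1 \<le> j \<and> j < j' \<and> j' \<le> q}"
      then obtain i i' where *: "t = (\<nu> (NB i), \<nu> (NB i'), \<nu> (NAA i i'))" "1 \<le> i" "i < i'" "i' \<le> q"
        by blast
      show ?thesis
        by (rule bexI[of _ "NAA i i'"]) (use * in \<open>simp_all add: f_def A_side_def\<close>)
    qed
    from f[OF t(1)] obtain l where l: "l \<in> ?N" "t = f l" "(\<lambda>(u, v, w). w) t = \<nu> l" by blast
    from f[OF t(2)] obtain l' where l': "l' \<in> ?N" "t' = f l'" "(\<lambda>(u, v, w). w) t' = \<nu> l'" by blast
    have "l = l'" using e l(3) l'(3) eq[OF l(1) l'(1)] by simp
    then show "t = t'" using l(2) l'(2) by simp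
  qed
  moreover have "verts (Kbip \<nu> p q) = verts (K \<nu> p q) \<union> (\<lambda>(u, v, w). w) ` ?T"
  proof -
    have W: "(\<lambda>(u, v, w). w) ` ?T = \<nu> ` {NBB i i' |i i'. 1 \<le> i \<and> i < i' \<and> i' \<le> p} \<union>
        \<nu> ` {NAA j j' |j j'. 1 \<le> j \<and> j < j' \<and> j' \<le> q}"
      (is "?l = ?r")
    proof
      show "?l \<subseteq> ?r" unfolding elim_triples_def by auto
      show "?r \<subseteq> ?l"
      proof
        fix w assume "w \<in> ?r"
        then consider i i' where "w = \<nu> (NBB i i')" "1 \<le> i" "i < i'" "i' \<le> p"
          | j j' where "w = \<nu> (NAA j j')" "1 \<le> j" "j < j'" "j' \<le> q" by blast
        then show "w \<in> ?l"
        proof cases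
          case (1 i i')
          then have "(\<nu> (NA i), \<nu> (NA i'), w) \<in> ?T" unfolding elim_triples_def by blast
          then show ?thesis by (rule image_eqI[rotated]) simp
        next
          case (2 j j')
          then have "(\<nu> (NB j), \<nu> (NB j'), w) \<in> ?T" unfolding elim_triples_def by blast
          then show ?thesis by (rule image_eqI[rotated]) simp
        qed
      qed
    qed
    show ?thesis unfolding W Kbip_def K_def complete_graph_def complete_bipartite_def fst_conv
      A_side_def B_side_def by blast
  qed
  moreover have "edges (Kbip \<nu> p q) \<inter> edges (K \<nu> p q) =
      edges (K \<nu> p q) - (\<lambda>(u, v, w). {u, v}) ` ?T" (is "?L = ?R")
  proof (intro set_eqI)
    fix e
    have TA: "{\<nu> (NA i), \<nu> (NA i')} \<in> (\<lambda>(u, v, w). {u, v}) ` ?T"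
      if "1 \<le> i" "i \<le> p" "1 \<le> i'" "i' \<le> p" "i \<noteq> i'" for i i'
    proof (cases "i < i'")
      case True
      then have "(\<nu> (NA i), \<nu> (NA i'), \<nu> (NBB i i')) \<in> ?T"
        using that unfolding elim_triples_def by blast
      then show ?thesis by force
    next
      case False
      then have "i' < i" using that by simp
      then have "(\<nu> (NA i'), \<nu> (NA i), \<nu> (NBB i' i)) \<in> ?T"
        using that unfolding elim_triples_def by blast
      then show ?thesis by (rule image_eqI[rotated]) (simp add: insert_commute)
    qed
    have TB: "{\<nu> (NB i), \<nu> (NB i')} \<in> (\<lambda>(u, v, w). {u, v}) ` ?T"
      if "1 \<le> i" "i \<le> q" "1 \<le> i'" "i' \<le> q" "i \<noteq> i'" for i i'
    proof (cases "i < i'")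
      case True
      then have "(\<nu> (NB i), \<nu> (NB i'), \<nu> (NAA i i')) \<in> ?T"
        using that unfolding elim_triples_def by blast
      then show ?thesis by force
    next
      case False
      then have "i' < i" using that by simp
      then have "(\<nu> (NB i'), \<nu> (NB i), \<nu> (NAA i' i)) \<in> ?T"
        using that unfolding elim_triples_def by blast
      then show ?thesis by (rule image_eqI[rotated]) (simp add: insert_commute)
    qed
    have dis: "A_side p q \<inter> B_side p q = {}"
      by (auto simp: A_side_def B_side_def A_nodes_def B_nodes_def)
    have notT: "e \<notin> edges (Kbip \<nu> p q)" if "e \<in> (\<lambda>(u, v, w). {u, v}) ` ?T"
    proof
      assume "e \<in> edges (Kbip \<nu> p q)"
      then obtain a b where ab: "e = {\<nu> a, \<nu> b}" "a \<in> A_side p q" "b \<in> B_side p q"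
        unfolding Kbip_def complete_bipartite_def by auto
      from that obtain t where t: "t \<in> ?T" "e = (\<lambda>(u, v, w). {u, v}) t" by blast
      from T[OF t(1)] obtain x y where xy: "e = {\<nu> x, \<nu> y}"
        "x \<in> A_side p q \<and> y \<in> A_side p q \<or> x \<in> B_side p q \<and> y \<in> B_side p q"
        using t(2) by auto
      have "\<nu> a = \<nu> x \<and> \<nu> b = \<nu> y \<or> \<nu> a = \<nu> y \<and> \<nu> b = \<nu> x"
        using ab(1) xy(1) by (auto simp: doubleton_eq_iff)
      then have "a = x \<and> b = y \<or> a = y \<and> b = x"
        using eq ab(2,3) xy(2) by blast
      then show False using dis ab xy(2) by blast
    qed
    have inT: "e \<in> edges (Kbip \<nu> p q)"
      if e: "e \<in> edges (K \<nu> p q)" "e \<notin> (\<lambda>(u, v, w). {u, v}) ` ?T"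
    proof -
      from e(1) obtain x y where xy: "e = {\<nu> x, \<nu> y}" "x \<in> A_nodes p \<union> B_nodes q"
        "y \<in> A_nodes p \<union> B_nodes q" "\<nu> x \<noteq> \<nu> y"
        unfolding K_def complete_graph_def by auto
      have "x \<in> A_nodes p \<and> y \<in> B_nodes q \<or> y \<in> A_nodes p \<and> x \<in> B_nodes q"
      proof (rule ccontr)
        assume "\<not> ?thesis"
        then have "x \<in> A_nodes p \<and> y \<in> A_nodes p \<or> x \<in> B_nodes q \<and> y \<in> B_nodes q"
          using xy by blast
        then show False
        proof
          assume "x \<in> A_nodes p \<and> y \<in> A_nodes p"
          then obtain i i' where "x = NA i" "y = NA i'" "1 \<le> i" "i \<le> p" "1 \<le> i'" "i' \<le> p"
            by (auto simp: A_nodes_def)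
          then show False using TA[of i i'] xy e(2) by auto
        next
          assume "x \<in> B_nodes q \<and> y \<in> B_nodes q"
          then obtain i i' where "x = NB i" "y = NB i'" "1 \<le> i" "i \<le> q" "1 \<le> i'" "i' \<le> q"
            by (auto simp: B_nodes_def)
          then show False using TB[of i i'] xy e(2) by auto
        qed
      qed
      moreover have "{\<nu> x, \<nu> y} = {\<nu> y, \<nu> x}" by (rule insert_commute)
      ultimately show ?thesis unfolding xy(1) Kbip_def complete_bipartite_def snd_conv
        A_side_def B_side_def by blast
    qed
    show "e \<in> ?L \<longleftrightarrow> e \<in> ?R" using notT inT by blast
  qed
  ultimately show ?thesis unfolding graph_tri_elim_def by blast
qed

end

theory Submission
  imports Defs
begin

text \<open>
  The right-hand side of a facet inducing inequality, and of its triangular eliminations, is the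
  maximum of the left-hand side over all cuts, so only the coefficients matter, and these are
  transformed by a permutation of the nodes and a sign that is negative on the edges of a cut.
  In the support of an eliminated inequality the new node of an edge \<open>uv\<close> has degree 2 if the coefficient of \<open>uv\<close> is nonzero and
  degree 0 otherwise, while an old node keeps its degree, which is 0 or at least 3 because the facet
  is not given by a triangle inequality: for a node \<open>w\<close> of smaller degree, moving \<open>w\<close> across tight
  cuts shows that all tight cuts satisfy a triangle equation or have a constant coordinate.
  Hence an automorphism of the bipartite graph maps old nodes of positive degree to old nodes, and
  the new node of an edge to the new node of the image edge.  The absolute value and the sign of the
  coefficient of \<open>uv\<close> are recovered from the two coefficients at its new node.  If the automorphism
  exchanges the sides, then \<open>r = s\<close>, which means \<open>p = q\<close> or \<open>p + q = 3\<close>.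
\<close>

section \<open>Switchings and permutations as signed relabellings\<close>

text \<open>Neither direction is a plain restriction or extension. An automorphism of the bipartite
  graph is unconstrained on nodes of degree 0 and may map an isolated old node to an isolated new
  one. Hence only its values on old nodes of positive degree are kept, and the rest is filled in by
  an arbitrary bijection that respects the sides; that zero coefficients correspond to zero
  coefficients is then obtained from the inverse automorphism. In the converse direction new nodes
  follow their edges, but the two eliminations may have used different triangular forms. For a
  nonzero coefficient of \<open>uv\<close> exactly two forms cancel it, and they differ by switching
  at the new node, so the choice is absorbed into the cut. Cuts are handled through signs: a set
  separates \<open>u\<close> from \<open>v\<close> iff the product of their signs is -1, and
  symmetric differences of sets become products.\<close>

definition sg :: "'v set \<Rightarrow> 'v \<Rightarrow> real" where
  "sg S u = (if u \<in> S then -1 else 1)"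

text \<open>Rules out singletons as edges, for which the test \<open>card (S \<inter> e) = 1\<close>
  would not agree with a product of the signs at two ends.\<close>

definition pair_graph :: "'v graph \<Rightarrow> bool" where
  "pair_graph G \<longleftrightarrow> (\<forall>e\<in>edges G. \<exists>u\<in>verts G. \<exists>v\<in>verts G. u \<noteq> v \<and> e = {u, v})"

text \<open>Weaker than inducing a facet. For the eliminated inequality this is the property that is
  established, since it determines the right-hand side from the coefficients.\<close>

definition tight :: "'v::finite graph \<Rightarrow> 'v ineq \<Rightarrow> bool" where
  "tight G = (\<lambda>(a, a0). (\<forall>S. S \<subseteq> verts G \<longrightarrow> a \<bullet> cut_vec G S \<le> a0) \<and>
     (\<exists>S. S \<subseteq> verts G \<and> a \<bullet> cut_vec G S = a0))"

text \<open>The coefficients \<open>b\<close> arise from \<open>a\<close> by relabelling along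
  \<open>\<sigma>\<close> and then switching at \<open>S\<close>, so signs are read at the nodes of
  \<open>b\<close>. Right-hand sides do not occur, and \<open>S\<close> may contain points outside
  the graph.\<close>

definition signed_eq :: "'v::finite graph \<Rightarrow> ('v \<Rightarrow> 'v) \<Rightarrow> 'v set \<Rightarrow> 'v evec \<Rightarrow> 'v evec \<Rightarrow> bool" where
  "signed_eq G \<sigma> S a b \<longleftrightarrow>
     (\<forall>u v. {u, v} \<in> edges G \<longrightarrow> b $ {u, v} = sg S u * sg S v * a $ {\<sigma> u, \<sigma> v})"

lemma abs_sg [simp]: "\<bar>sg S u\<bar> = 1"
  by (auto simp: sg_def)

lemma card_Int_pair: "u \<noteq> v \<Longrightarrow> card (S \<inter> {u, v}) = Suc 0 \<longleftrightarrow> (u \<in> S) \<noteq> (v \<in> S)"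
  by (cases "u \<in> S"; cases "v \<in> S") auto

lemma pair_graphE:
  assumes "pair_graph G" "e \<in> edges G"
  obtains u v where "u \<in> verts G" "v \<in> verts G" "u \<noteq> v" "e = {u, v}"
  using assms unfolding pair_graph_def by blast

lemma pair_graph_edgeD:
  assumes "pair_graph G" "{u, v} \<in> edges G"
  shows "u \<in> verts G" "v \<in> verts G" "u \<noteq> v"
proof -
  obtain x y where "x \<in> verts G" "y \<in> verts G" "x \<noteq> y" "{u, v} = {x, y}"
    using assms by (rule pair_graphE)
  then show "u \<in> verts G" "v \<in> verts G" "u \<noteq> v" by (auto simp: doubleton_eq_iff)
qed

lemma cut_vec_pair:
  assumes "pair_graph G" "{u, v} \<in> edges G"
  shows "cut_vec G S $ {u, v} = (if (u \<in> S) \<noteq> (v \<in> S) then 1 else 0)"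
  using pair_graph_edgeD(3)[OF assms] assms(2) by (simp add: cut_vec_def card_Int_pair)

lemma switching_coeff:
  "u \<noteq> v \<Longrightarrow> fst (switching G S (a, a0)) $ {u, v} = sg S u * sg S v * a $ {u, v}"
  by (simp add: switching_def card_Int_pair sg_def)

lemma edge_space_eqI:
  assumes "pair_graph G" "a \<in> edge_space G" "b \<in> edge_space G"
    and "\<And>u v. {u, v} \<in> edges G \<Longrightarrow> a $ {u, v} = b $ {u, v}"
  shows "a = b"
proof (rule vec_eq_iff[THEN iffD2], rule allI)
  fix e show "a $ e = b $ e"
  proof (cases "e \<in> edges G")
    case True
    then show ?thesis using assms(1,4) by (auto elim!: pair_graphE)
  next
    case False
    then show ?thesis using assms(2,3) by (simp add: edge_space_def)
  qed
qed

lemma automorphism_edge_iff: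
  assumes "pair_graph G" "\<sigma> \<in> automorphisms G"
  shows "\<sigma> ` e \<in> edges G \<longleftrightarrow> e \<in> edges G"
proof
  have p: "\<sigma> permutes verts G" using assms by (simp add: automorphisms_def)
  assume "\<sigma> ` e \<in> edges G"
  then obtain u v where uv: "u \<in> verts G" "v \<in> verts G" "\<sigma> ` e = {u, v}" "{u, v} \<in> edges G"
    by (metis assms(1) pair_graphE)
  define x y where "x = inv \<sigma> u" and "y = inv \<sigma> v"
  have xy: "x \<in> verts G" "y \<in> verts G" "\<sigma> x = u" "\<sigma> y = v"
    using p uv by (simp_all add: x_def y_def permutes_inverses permutes_in_image[OF permutes_inv])
  then have "\<sigma> ` e = \<sigma> ` {x, y}" using uv by simp
  then have "e = {x, y}" unfolding inj_image_eq_iff[OF permutes_inj[OF p],of e "{x, y}"] .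
  then show "e \<in> edges G" using xy uv assms(2) by (simp add: automorphisms_def)
next
  assume "e \<in> edges G"
  then show "\<sigma> ` e \<in> edges G" using assms by (auto simp: automorphisms_def elim!: pair_graphE)
qed

text \<open>The inner product is reindexed along the map that \<open>\<sigma>\<close> induces on all
  sets of nodes, a bijection carrying the cut of \<open>T\<close> to the cut of its image.\<close>

lemma cut_vec_permutation:
  assumes "pair_graph G" "\<sigma> \<in> automorphisms G"
  shows "fst (permutation_of \<sigma> (a, a0)) \<bullet> cut_vec G T = a \<bullet> cut_vec G (\<sigma> ` T)"
proof -
  have p: "bij \<sigma>" using assms by (auto simp: automorphisms_def intro: permutes_bij)
  have "cut_vec G T $ e = cut_vec G (\<sigma> ` T) $ (\<sigma> ` e)" for e
  proof -
    have "card (\<sigma> ` (T \<inter> e)) = card (T \<inter> e)"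
      using p by (intro card_image) (meson bij_is_inj inj_on_subset subset_UNIV)
    then have "card (\<sigma> ` T \<inter> \<sigma> ` e) = card (T \<inter> e)"
      using p by (simp add: image_Int bij_is_inj)
    then show ?thesis using automorphism_edge_iff[OF assms] by (simp add: cut_vec_def)
  qed
  moreover have "bij (image \<sigma>)"
    using p by (metis bij_betw_Pow Pow_UNIV)
  ultimately show ?thesis
    unfolding permutation_of_def inner_vec_def
    by (simp add: sum.reindex_bij_betw[of "image \<sigma>" UNIV UNIV "\<lambda>e. a $ e * cut_vec G (\<sigma> ` T) $ e"])
qed

text \<open>A coordinate of the cut of a symmetric difference is \<open>x + y - 2 * x * y\<close> in
  the 0/1 coordinates \<open>x\<close> and \<open>y\<close> of the two cuts. Subtracting the one for
  \<open>S\<close> leaves the one for \<open>T\<close> times the sign by which switching changes the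
  coefficient.\<close>

lemma cut_vec_switching:
  assumes "pair_graph G"
  shows "fst (switching G S (a, a0)) \<bullet> cut_vec G T = a \<bullet> cut_vec G (sym_diff T S) - a \<bullet> cut_vec G S"
proof -
  have "fst (switching G S (a, a0)) $ e * cut_vec G T $ e =
      a $ e * cut_vec G (sym_diff T S) $ e - a $ e * cut_vec G S $ e" for e
  proof (cases "e \<in> edges G")
    case True
    then obtain u v where "u \<noteq> v" "e = {u, v}" by (metis assms pair_graphE)
    then show ?thesis using True cut_vec_pair[OF assms, of u v]
      by (auto simp: switching_coeff sg_def)
  qed (simp add: cut_vec_def)
  then show ?thesis by (simp add: inner_vec_def sum_subtractf)
qed

lemma tight_unique: "tight G (a, a0) \<Longrightarrow> tight G (a, a1) \<Longrightarrow> a0 = a1"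
  unfolding tight_def by (simp, metis order_antisym)

text \<open>Both operations permute the cuts. Switching shifts all values by the same amount as the
  right-hand side; a permutation of the nodes leaves the values as they are.\<close>

lemma tight_ps_step:
  assumes "pair_graph G" "P \<subseteq> automorphisms G" "ps_step G P I J" "tight G I"
  shows "tight G J"
  using assms(3)
proof cases
  case (switch S)
  obtain a a0 where I: "I = (a, a0)" by (cases I)
  obtain S0 where S0: "S0 \<subseteq> verts G" "a \<bullet> cut_vec G S0 = a0" and
    le: "\<And>S. S \<subseteq> verts G \<Longrightarrow> a \<bullet> cut_vec G S \<le> a0"
    using assms(4) by (auto simp: tight_def I)
  have J: "J = (fst (switching G S (a, a0)), a0 - a \<bullet> cut_vec G S)"
    by (simp add: switch I switching_def)
  have "sym_diff (sym_diff S0 S) S = S0" by auto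
  then have "\<exists>T. T \<subseteq> verts G \<and> a \<bullet> cut_vec G (sym_diff T S) = a0"
    using S0 switch(2) by (intro exI[of _ "sym_diff S0 S"]) auto
  moreover have "a \<bullet> cut_vec G (sym_diff T S) \<le> a0" if "T \<subseteq> verts G" for T
    using that switch(2) by (intro le) auto
  ultimately show ?thesis
    unfolding J tight_def by (simp add: cut_vec_switching[OF assms(1)])
next
  case (permute \<sigma>)
  obtain a a0 where I: "I = (a, a0)" by (cases I)
  obtain S0 where S0: "S0 \<subseteq> verts G" "a \<bullet> cut_vec G S0 = a0" and
    le: "\<And>S. S \<subseteq> verts G \<Longrightarrow> a \<bullet> cut_vec G S \<le> a0"
    using assms(4) by (auto simp: tight_def I)
  have au: "\<sigma> \<in> automorphisms G" using permute assms(2) by auto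
  then have p: "\<sigma> permutes verts G" by (simp add: automorphisms_def)
  have J: "J = (fst (permutation_of \<sigma> (a, a0)), a0)"
    by (simp add: permute I permutation_of_def)
  have "\<sigma> ` inv \<sigma> ` S0 = S0" "inv \<sigma> ` S0 \<subseteq> verts G"
    using p S0(1) permutes_image[OF permutes_inv[OF p]]
    by (auto simp: image_comp permutes_inv_o permutes_in_image[OF permutes_inv])
  moreover have "\<sigma> ` T \<subseteq> verts G" if "T \<subseteq> verts G" for T
    using that permutes_image[OF p] by auto
  ultimately show ?thesis
    using S0 le unfolding J tight_def prod.case cut_vec_permutation[OF assms(1) au] by metis
qed

lemma edge_space_ps_step:
  assumes "pair_graph G" "P \<subseteq> automorphisms G" "ps_step G P I J" "fst I \<in> edge_space G"
  shows "fst J \<in> edge_space G"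
  using assms(3)
proof cases
  case (switch S)
  then show ?thesis using assms(4) by (auto simp: switching_def edge_space_def case_prod_beta)
next
  case (permute \<sigma>)
  then have "\<sigma> \<in> automorphisms G" using assms(2) by auto
  then show ?thesis using permute assms(4) automorphism_edge_iff[OF assms(1)]
    by (auto simp: permutation_of_def edge_space_def case_prod_beta)
qed

text \<open>Switching twice along \<open>S\<close> also restores the right-hand side, because the
  switched coefficients take the negated value on the cut of \<open>S\<close>.\<close>

lemma ps_step_sym:
  assumes inv: "\<And>\<sigma>. \<sigma> \<in> P \<Longrightarrow> inv \<sigma> \<in> P" and P: "P \<subseteq> automorphisms G" and "pair_graph G"
    and "ps_step G P I J"
  shows "ps_step G P J I"
  using assms(4)
proof cases
  case (switch S)
  obtain a a0 where I: "I = (a, a0)" by (cases I)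
  have "cut_vec G (sym_diff S S) = 0" by (simp add: cut_vec_def vec_eq_iff)
  with cut_vec_switching[OF assms(3), of S a a0 S]
  have "fst (switching G S (a, a0)) \<bullet> cut_vec G S = - (a \<bullet> cut_vec G S)" by simp
  then have "switching G S J = I"
    unfolding switch I by (auto simp: switching_def vec_eq_iff)
  then show ?thesis using ps_step.switch[OF switch(2), of P J] by simp
next
  case (permute \<sigma>)
  then have "\<sigma> permutes verts G" using P by (auto simp: automorphisms_def)
  then have "permutation_of (inv \<sigma>) J = I"
    by (cases I) (simp add: permute permutation_of_def vec_eq_iff image_comp permutes_inv_o)
  then show ?thesis using ps_step.permute[OF inv[OF permute(2)], of G J] by simp
qed

text \<open>A permutation moves past a switching by replacing the switching set with its preimage,
  so any sequence collapses to one relabelling followed by one switching. \<open>P\<close> holds the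
  allowed steps, \<open>Q\<close> a set around it that is closed under composition.\<close>

lemma signed_eq_ps_steps:
  assumes "pair_graph G" "P \<subseteq> Q" "Q \<subseteq> automorphisms G" "id \<in> Q"
    and comp: "\<And>\<sigma> \<tau>. \<sigma> \<in> Q \<Longrightarrow> \<tau> \<in> Q \<Longrightarrow> \<sigma> \<circ> \<tau> \<in> Q"
    and "(ps_step G P)\<^sup>*\<^sup>* I J"
  shows "\<exists>\<sigma>\<in>Q. \<exists>S. signed_eq G \<sigma> S (fst I) (fst J)"
  using assms(6)
proof induction
  case base
  then show ?case using assms(4) by (intro bexI[of _ id] exI[of _ "{}"]) (auto simp: signed_eq_def sg_def)
next
  case (step J J')
  then obtain \<sigma> S where \<sigma>: "\<sigma> \<in> Q" "signed_eq G \<sigma> S (fst I) (fst J)" by auto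
  show ?case using step(2)
  proof cases
    case (switch T)
    have "sg (sym_diff S T) u = sg T u * sg S u" for u by (auto simp: sg_def)
    then have "signed_eq G \<sigma> (sym_diff S T) (fst I) (fst J')"
      using \<sigma>(2) pair_graph_edgeD(3)[OF assms(1)] unfolding signed_eq_def switch
      by (cases J) (auto simp: switching_coeff)
    then show ?thesis using \<sigma>(1) by blast
  next
    case (permute \<tau>)
    have \<tau>: "\<tau> \<in> Q" "\<tau> \<in> automorphisms G" using permute assms(2,3) by auto
    have "sg (\<tau> -` S) u = sg S (\<tau> u)" for u by (simp add: sg_def)
    then have "signed_eq G (\<sigma> \<circ> \<tau>) (\<tau> -` S) (fst I) (fst J')"
      using \<sigma>(2) automorphism_edge_iff[OF assms(1) \<tau>(2), of "{u, v}" for u v]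
      unfolding signed_eq_def permute
      by (cases J) (auto simp: permutation_of_def)
    then show ?thesis using comp[OF \<sigma>(1) \<tau>(1)] by blast
  qed
qed

text \<open>\<open>P\<close> and \<open>Q\<close> are separate because permutations within one side,
  together with a swap, need not be closed under composition; \<open>gen\<close> says that steps
  from \<open>P\<close> reach every relabelling in \<open>Q\<close>. One signed relabelling gives
  both directions since single steps are reversible.\<close>

lemma transformable_iff_signed_eq:
  assumes G: "pair_graph G" and PQ: "P \<subseteq> Q" "Q \<subseteq> automorphisms G" "id \<in> Q"
    and comp: "\<And>\<sigma> \<tau>. \<sigma> \<in> Q \<Longrightarrow> \<tau> \<in> Q \<Longrightarrow> \<sigma> \<circ> \<tau> \<in> Q"
    and inv: "\<And>\<sigma>. \<sigma> \<in> P \<Longrightarrow> inv \<sigma> \<in> P"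
    and gen: "\<And>\<sigma> I. \<sigma> \<in> Q \<Longrightarrow> (ps_step G P)\<^sup>*\<^sup>* I (permutation_of \<sigma> I)"
    and ab: "a \<in> edge_space G" "b \<in> edge_space G" "tight G (a, a0)" "tight G (b, b0)"
  shows "transformable G P (a, a0) (b, b0) \<longleftrightarrow> (\<exists>\<sigma>\<in>Q. \<exists>S. signed_eq G \<sigma> S a b)"
proof
  assume "transformable G P (a, a0) (b, b0)"
  then show "\<exists>\<sigma>\<in>Q. \<exists>S. signed_eq G \<sigma> S a b"
    using signed_eq_ps_steps[OF G PQ comp, of "(a, a0)" "(b, b0)"] by (auto simp: transformable_def)
next
  have PA: "P \<subseteq> automorphisms G" using PQ by auto
  assume "\<exists>\<sigma>\<in>Q. \<exists>S. signed_eq G \<sigma> S a b"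
  then obtain \<sigma> S where \<sigma>: "\<sigma> \<in> Q" "signed_eq G \<sigma> S a b" by blast
  \<comment> \<open>Switching steps admit only sets of nodes of the graph, so \<open>S\<close> is
    cut down; the signs at the ends of edges stay the same.\<close>
  define J where "J = switching G (S \<inter> verts G) (permutation_of \<sigma> (a, a0))"
  have steps: "(ps_step G P)\<^sup>*\<^sup>* (a, a0) J"
    unfolding J_def by (rule rtranclp.rtrancl_into_rtrancl[OF gen[OF \<sigma>(1)]]) (simp add: ps_step.switch)
  then have J: "fst J \<in> edge_space G \<and> tight G J"
    by induction (use ab edge_space_ps_step[OF G PA] tight_ps_step[OF G PA] in auto)
  have "fst J = b"
  proof (rule edge_space_eqI[OF G _ ab(2)])
    fix u v assume uv: "{u, v} \<in> edges G"
    note d = pair_graph_edgeD[OF G uv]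
    have "sg (S \<inter> verts G) u = sg S u" "sg (S \<inter> verts G) v = sg S v" using d by (auto simp: sg_def)
    then show "fst J $ {u, v} = b $ {u, v}"
      using \<sigma>(2) uv d by (simp add: J_def permutation_of_def switching_coeff signed_eq_def)
  qed (use J in simp)
  \<comment> \<open>The steps preserve tightness, which forces equal right-hand sides once the
    coefficients agree.\<close>
  then have "J = (b, b0)" using J ab(4) tight_unique by (metis prod.collapse)
  then have *: "(ps_step G P)\<^sup>*\<^sup>* (a, a0) (b, b0)" using steps by simp
  have "symp (ps_step G P)" using ps_step_sym[OF inv PA G] by (auto intro: sympI)
  then have "symp (ps_step G P)\<^sup>*\<^sup>*" by (rule symp_rtranclp)
  then show "transformable G P (a, a0) (b, b0)" using * by (simp add: transformable_def sympD)
qed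

lemma automorphism_inv:
  assumes "pair_graph G" "\<sigma> \<in> automorphisms G"
  shows "inv \<sigma> \<in> automorphisms G"
proof -
  have p: "\<sigma> permutes verts G" using assms by (simp add: automorphisms_def)
  have "{u, v} \<in> edges G \<longleftrightarrow> {inv \<sigma> u, inv \<sigma> v} \<in> edges G" for u v
    using automorphism_edge_iff[OF assms, of "{inv \<sigma> u, inv \<sigma> v}"] p by (simp add: permutes_inverses)
  then show ?thesis using permutes_inv[OF p] by (simp add: automorphisms_def)
qed

lemma automorphism_comp:
  assumes "pair_graph G" "\<sigma> \<in> automorphisms G" "\<tau> \<in> automorphisms G"
  shows "\<sigma> \<circ> \<tau> \<in> automorphisms G"
proof -
  have "{u, v} \<in> edges G \<longleftrightarrow> {\<sigma> (\<tau> u), \<sigma> (\<tau> v)} \<in> edges G" for u v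
    using automorphism_edge_iff[OF assms(1,2), of "{\<tau> u, \<tau> v}"]
      automorphism_edge_iff[OF assms(1,3), of "{u, v}"] by simp
  then show ?thesis using assms(2,3) by (simp add: automorphisms_def permutes_compose)
qed

lemma ps_equivalent_iff_signed_eq:
  assumes G: "pair_graph G"
    and ab: "a \<in> edge_space G" "b \<in> edge_space G" "tight G (a, a0)" "tight G (b, b0)"
  shows "ps_equivalent G (a, a0) (b, b0) \<longleftrightarrow> (\<exists>\<sigma>\<in>automorphisms G. \<exists>S. signed_eq G \<sigma> S a b)"
  unfolding ps_equivalent_def
proof (rule transformable_iff_signed_eq[OF G subset_refl subset_refl _ _ _ _ ab])
  show "id \<in> automorphisms G" by (simp add: automorphisms_def permutes_id)
  show "\<sigma> \<circ> \<tau> \<in> automorphisms G" if "\<sigma> \<in> automorphisms G" "\<tau> \<in> automorphisms G" for \<sigma> \<tau>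
    using automorphism_comp[OF G that] .
  show "inv \<sigma> \<in> automorphisms G" if "\<sigma> \<in> automorphisms G" for \<sigma>
    using automorphism_inv[OF G that] .
  show "(ps_step G (automorphisms G))\<^sup>*\<^sup>* I (permutation_of \<sigma> I)" if "\<sigma> \<in> automorphisms G" for \<sigma> I
    using ps_step.permute[OF that] by (rule r_into_rtranclp)
qed

lemma signed_eq_inv:
  assumes "pair_graph G" "\<sigma> \<in> automorphisms G" "signed_eq G \<sigma> S a b"
  shows "signed_eq G (inv \<sigma>) (\<sigma> ` S) b a"
  unfolding signed_eq_def
proof (intro allI impI)
  fix u v assume uv: "{u, v} \<in> edges G"
  have p: "\<sigma> permutes verts G" using assms by (simp add: automorphisms_def)
  have "{inv \<sigma> u, inv \<sigma> v} \<in> edges G"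
    using automorphism_edge_iff[OF assms(1,2), of "{inv \<sigma> u, inv \<sigma> v}"] uv p by (simp add: permutes_inverses)
  then have "b $ {inv \<sigma> u, inv \<sigma> v} = sg S (inv \<sigma> u) * sg S (inv \<sigma> v) * a $ {u, v}"
    using assms(3) p by (simp add: signed_eq_def permutes_inverses)
  moreover have "sg (\<sigma> ` S) x = sg S (inv \<sigma> x)" for x
    using p by (auto simp: sg_def permutes_inverses image_iff)
  ultimately show "a $ {u, v} = sg (\<sigma> ` S) u * sg (\<sigma> ` S) v * b $ {inv \<sigma> u, inv \<sigma> v}"
    by (auto simp: sg_def)
qed

section \<open>Node degrees in the support of a facet\<close>

lemma pair_graph_complete: "pair_graph (complete_graph V)"
  by (auto simp: pair_graph_def complete_graph_def)

lemma complete_graph_simps [simp]: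
  "verts (complete_graph V) = V"
  "{u, v} \<in> edges (complete_graph V) \<longleftrightarrow> u \<in> V \<and> v \<in> V \<and> u \<noteq> v"
  by (auto simp: complete_graph_def doubleton_eq_iff)

lemma cut_vec_complete:
  "u \<in> V \<Longrightarrow> v \<in> V \<Longrightarrow> u \<noteq> v \<Longrightarrow>
    cut_vec (complete_graph V) S $ {u, v} = (if (u \<in> S) \<noteq> (v \<in> S) then 1 else 0)"
  by (simp add: cut_vec_pair[OF pair_graph_complete])

text \<open>The cut polytope of a complete graph is full-dimensional, because
  \<open>\<delta>{u} + \<delta>{v} - \<delta>{u, v}\<close> is twice a unit vector.\<close>

lemma edge_space_subset_span_cuts:
  fixes V :: "'v::finite set"
  shows "edge_space (complete_graph V) \<subseteq> span {cut_vec (complete_graph V) S |S. S \<subseteq> V}"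
    (is "_ \<subseteq> span ?C")
proof
  fix x assume x: "x \<in> edge_space (complete_graph V)"
  let ?K = "complete_graph V"
  have ax: "axis e 1 \<in> span {cut_vec ?K S |S. S \<subseteq> V}" if e: "e \<in> edges ?K" for e :: "'v set"
  proof -
    obtain u v where uv: "u \<in> V" "v \<in> V" "u \<noteq> v" "e = {u, v}"
      using pair_graphE[OF pair_graph_complete e] by auto
    have "2 *\<^sub>R axis e 1 = cut_vec ?K {u} + cut_vec ?K {v} - cut_vec ?K {u, v}"
    proof (rule vec_eq_iff[THEN iffD2], rule allI)
      fix f
      show "(2 *\<^sub>R axis e 1) $ f = (cut_vec ?K {u} + cut_vec ?K {v} - cut_vec ?K {u, v}) $ f"
      proof (cases "f \<in> edges ?K")
        case True
        then obtain y z where "y \<in> V" "z \<in> V" "y \<noteq> z" "f = {y, z}"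
          using pair_graphE[OF pair_graph_complete True] by auto
        then show ?thesis using uv(3,4) by (auto simp: cut_vec_complete axis_def doubleton_eq_iff)
      next
        case False
        then have "f \<noteq> e" using e by auto
        then show ?thesis using False by (simp add: cut_vec_def axis_def)
      qed
    qed
    moreover have "cut_vec ?K {u} \<in> span {cut_vec ?K S |S. S \<subseteq> V}"
      "cut_vec ?K {v} \<in> span {cut_vec ?K S |S. S \<subseteq> V}"
      "cut_vec ?K {u, v} \<in> span {cut_vec ?K S |S. S \<subseteq> V}"
      using uv by (auto intro!: span_base)
    ultimately have "2 *\<^sub>R axis e 1 \<in> span {cut_vec ?K S |S. S \<subseteq> V}"
      by (simp only: span_add span_diff)
    from span_scale[OF this, of "1/2"] show ?thesis by simp
  qed
  have "x = (\<Sum>e\<in>UNIV. x $ e *\<^sub>R axis e 1)"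
    using basis_expansion[of x] by (simp add: scalar_mult_eq_scaleR)
  also have "\<dots> \<in> span {cut_vec ?K S |S. S \<subseteq> V}"
  proof (rule span_sum)
    fix e show "x $ e *\<^sub>R axis e 1 \<in> span {cut_vec ?K S |S. S \<subseteq> V}"
      using ax[of e] x by (cases "e \<in> edges ?K") (auto simp: edge_space_def span_scale span_zero)
  qed
  finally show "x \<in> span ?C" .
qed

text \<open>A face of the hull of a compact set is the hull of some of its generators, and these lie
  in the face. Linear equations that hold at the tight cuts therefore hold on the whole
  facet.\<close>

lemma facet_inducing_tight_cuts:
  assumes "facet_inducing G (a, a0)"
  obtains C where "C \<noteq> {}" "C \<subseteq> {cut_vec G S |S. S \<subseteq> verts G \<and> a \<bullet> cut_vec G S = a0}"
    "{x \<in> cut_polytope G. a \<bullet> x = a0} = convex hull C"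
proof -
  let ?C = "{cut_vec G S |S. S \<subseteq> verts G}"
  have f: "{x \<in> cut_polytope G. a \<bullet> x = a0} face_of convex hull ?C"
    "{x \<in> cut_polytope G. a \<bullet> x = a0} \<noteq> {}"
    using assms by (auto simp: facet_inducing_def facet_of_def cut_polytope_def)
  have "compact ?C" by (rule finite_imp_compact) simp
  then obtain C where C: "C \<subseteq> ?C" "{x \<in> cut_polytope G. a \<bullet> x = a0} = convex hull C"
    using f(1) by (rule face_of_convex_hull_subset)
  have "C \<noteq> {}" using C f(2) by auto
  moreover have "C \<subseteq> {x \<in> cut_polytope G. a \<bullet> x = a0}" using C(2) hull_subset by metis
  ultimately show thesis using C by (intro that[of C]) blast+
qed

lemma facet_inducing_tight:
  assumes "facet_inducing G (a, a0)"
  shows "tight G (a, a0)"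
proof -
  obtain C where C: "C \<noteq> {}" "C \<subseteq> {cut_vec G S |S. S \<subseteq> verts G \<and> a \<bullet> cut_vec G S = a0}"
    using facet_inducing_tight_cuts[OF assms] .
  have "cut_vec G S \<in> cut_polytope G" if "S \<subseteq> verts G" for S
    unfolding cut_polytope_def using that by (intro hull_inc) blast
  then show ?thesis using C assms unfolding tight_def facet_inducing_def by auto
qed

text \<open>The directions inside the facet have dimension one less than the polytope, and the
  polytope spans the edge space. So within the edge space only the multiples of \<open>a\<close> are
  orthogonal to all of them, and an equation satisfied by every tight cut is a multiple of the facet
  equation.\<close>

lemma facet_inducing_hyperplane_unique:
  fixes V :: "'v::finite set"
  assumes facet: "facet_inducing (complete_graph V) (a, a0)"
    and c: "c \<in> edge_space (complete_graph V)"
    and eq: "\<And>S. S \<subseteq> V \<Longrightarrow> a \<bullet> cut_vec (complete_graph V) S = a0 \<Longrightarrow>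
      c \<bullet> cut_vec (complete_graph V) S = c0"
  shows "a \<noteq> 0 \<and> (\<exists>\<mu>. c = \<mu> *\<^sub>R a \<and> c0 = \<mu> * a0)"
proof -
  let ?K = "complete_graph V"
  let ?P = "cut_polytope ?K"
  define F where "F = {x \<in> ?P. a \<bullet> x = a0}"
  have aE: "a \<in> edge_space ?K" using facet by (simp add: facet_inducing_def)
  have F: "F \<noteq> {}" "aff_dim F = aff_dim ?P - 1"
    using facet by (auto simp: facet_inducing_def facet_of_def F_def)
  then obtain x0 where x0: "x0 \<in> F" by auto
  have cF: "c \<bullet> x = c0" if "x \<in> F" for x
  proof -
    obtain C where C: "C \<noteq> {}" "C \<subseteq> {cut_vec ?K S |S. S \<subseteq> verts ?K \<and> a \<bullet> cut_vec ?K S = a0}"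
        "{x \<in> ?P. a \<bullet> x = a0} = convex hull C"
      using facet_inducing_tight_cuts[OF facet] .
    from C(2) have "C \<subseteq> {x. c \<bullet> x = c0}" using eq by auto
    then have "convex hull C \<subseteq> {x. c \<bullet> x = c0}"
      by (rule hull_minimal) (rule convex_hyperplane)
    then show ?thesis using that unfolding F_def C(3) by blast
  qed
  have sub: "edge_space ?K \<subseteq> span ?P"
    using edge_space_subset_span_cuts[of V] span_mono[OF hull_subset[of "{cut_vec ?K S |S. S \<subseteq> V}" convex]]
    unfolding cut_polytope_def by auto
  \<comment> \<open>The empty cut puts the origin into the polytope, so its affine dimension is the
    dimension of its linear span.\<close>
  have "cut_vec ?K {} = 0" by (simp add: cut_vec_def vec_eq_iff)
  then have "0 \<in> ?P" unfolding cut_polytope_def by (intro hull_inc) auto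
  then have dimP: "aff_dim ?P = int (dim ?P)" by (intro aff_dim_zero hull_inc)
  define D where "D = (\<lambda>x. x - x0) ` F"
  have dimD: "aff_dim F = int (dim D)"
    unfolding D_def using x0 by (intro aff_dim_eq_dim_subtract hull_inc)
  have "F \<subseteq> ?P" by (auto simp: F_def)
  have "x - x0 \<in> span ?P" if "x \<in> F" for x
    using that x0 \<open>F \<subseteq> ?P\<close> by (intro span_diff span_base) auto
  then have DP: "D \<subseteq> span ?P" by (auto simp: D_def)
  have orthD: "z \<bullet> d = 0" if "d \<in> span D" "\<And>d. d \<in> D \<Longrightarrow> z \<bullet> d = 0" for z d
    using span_subspace[of D "{d. z \<bullet> d = 0}"] that subspace_hyperplane[of z]
    by (metis (mono_tags, lifting) mem_Collect_eq span_induct subspace_def)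
  have aD: "a \<bullet> d = 0" and cD: "c \<bullet> d = 0" if "d \<in> D" for d
    using that x0 cF by (auto simp: D_def F_def inner_diff_right)
  have dims: "dim D + 1 = dim ?P" using F(2) dimP dimD by simp
  have "a \<noteq> 0"
  proof
    assume "a = 0"
    then have "F = {} \<or> F = ?P" by (auto simp: F_def)
    then show False using F by auto
  qed
  \<comment> \<open>The component of \<open>c\<close> orthogonal to \<open>a\<close>. If it were
    nonzero, \<open>D\<close>, \<open>a\<close> and \<open>y\<close> would span two dimensions more
    than \<open>D\<close>, while the span of the polytope has only one more.\<close>
  define y where "y = c - ((c \<bullet> a) / (a \<bullet> a)) *\<^sub>R a"
  have ya: "y \<bullet> a = 0" using \<open>a \<noteq> 0\<close> by (simp add: y_def inner_diff_left)
  have yD: "y \<bullet> d = 0" if "d \<in> D" for d using that aD cD by (simp add: y_def inner_diff_left)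
  have "y = 0"
  proof (rule ccontr)
    assume "y \<noteq> 0"
    have "a \<notin> span D" using orthD[of a a] aD \<open>a \<noteq> 0\<close> by auto
    moreover have "y \<notin> span (insert a D)"
    proof
      assume "y \<in> span (insert a D)"
      then obtain k where "y - k *\<^sub>R a \<in> span D" by (metis span_breakdown_eq)
      then have "y \<bullet> (y - k *\<^sub>R a) = 0" using orthD yD by blast
      then show False using ya \<open>y \<noteq> 0\<close> by (simp add: inner_diff_right)
    qed
    ultimately have "dim (insert y (insert a D)) = dim D + 2" by (simp add: dim_insert)
    moreover have "y \<in> edge_space ?K" using aE c by (simp add: y_def edge_space_def)
    then have "insert y (insert a D) \<subseteq> span ?P" using sub aE DP by auto
    then have "dim (insert y (insert a D)) \<le> dim ?P" by (metis dim_span dim_subset)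
    ultimately show False using dims by simp
  qed
  then have "c = ((c \<bullet> a) / (a \<bullet> a)) *\<^sub>R a" by (simp add: y_def)
  moreover have "c0 = ((c \<bullet> a) / (a \<bullet> a)) * a0"
    using cF[OF x0] x0 calculation by (metis (mono_tags, lifting) F_def inner_scaleR_left mem_Collect_eq)
  ultimately show ?thesis using \<open>a \<noteq> 0\<close> by blast
qed

section \<open>The support graph of a facet and its nodes of small degree\<close>

definition nb :: "'v::finite evec \<Rightarrow> 'v \<Rightarrow> 'v set" where
  "nb a u = {v. a $ {u, v} \<noteq> 0}"

lemma nb_edge: "a \<in> edge_space G \<Longrightarrow> v \<in> nb a u \<Longrightarrow> {u, v} \<in> edges G"
  by (auto simp: nb_def edge_space_def)

lemma nb_complete:
  assumes "a \<in> edge_space (complete_graph V)" "v \<in> nb a u"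
  shows "u \<in> V" "v \<in> V" "v \<noteq> u"
  using nb_edge[OF assms] unfolding complete_graph_simps by auto

lemma inner_axis_edge: "axis e 1 \<bullet> (x :: 'v::finite evec) = x $ e"
  by (simp add: inner_axis')

lemma axis_edge_space: "e \<in> edges G \<Longrightarrow> axis e (1::real) \<in> edge_space G"
  by (auto simp: edge_space_def axis_def)

text \<open>The third node shows that a facet of a cut polytope on at least three nodes lies in no
  coordinate hyperplane: a constant \<open>x\<^sub>u\<^sub>w\<close> forces a relation between \<open>x\<^sub>w\<^sub>t\<close> and \<open>x\<^sub>u\<^sub>t\<close>.\<close>

lemma facet_not_in_edge_hyperplane:
  fixes V :: "'v::finite set"
  assumes facet: "facet_inducing (complete_graph V) (a, a0)" and "card V \<ge> 3"
    and uw: "u \<in> V" "w \<in> V" "u \<noteq> w"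
    and eq: "\<And>S. S \<subseteq> V \<Longrightarrow> a \<bullet> cut_vec (complete_graph V) S = a0 \<Longrightarrow> (u \<in> S) \<noteq> (w \<in> S) \<longleftrightarrow> k"
  shows False
proof -
  let ?K = "complete_graph V"
  have "card {u, w} < card V" using assms(2) uw by simp
  then have "V - {u, w} \<noteq> {}" by (metis Diff_eq_empty_iff card_mono finite finite.emptyI finite_insert leD)
  then obtain t where t: "t \<in> V" "t \<noteq> u" "t \<noteq> w" by auto
  define c1 :: "'v evec" where "c1 = axis {u, w} 1"
  \<comment> \<open>If \<open>u\<close> and \<open>w\<close> are always separated, exactly one of
    them is separated from \<open>t\<close>, so
    \<open>x\<^sub>w\<^sub>t + x\<^sub>u\<^sub>t = 1\<close>; if they are never separated,
    \<open>x\<^sub>w\<^sub>t - x\<^sub>u\<^sub>t = 0\<close>.\<close>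
  define c2 :: "'v evec" where "c2 = axis {w, t} 1 + (if k then 1 else -1) *\<^sub>R axis {u, t} 1"
  have "c1 \<in> edge_space ?K" using uw by (simp add: c1_def axis_edge_space)
  moreover have "c1 \<bullet> cut_vec ?K S = (if k then 1 else 0)"
    if "S \<subseteq> V" "a \<bullet> cut_vec ?K S = a0" for S
    using eq[OF that] uw by (simp add: c1_def inner_axis_edge cut_vec_complete)
  ultimately obtain \<mu>1 where a0: "a \<noteq> 0" and 1: "c1 = \<mu>1 *\<^sub>R a"
    using facet_inducing_hyperplane_unique[OF facet] by metis
  have "c2 \<in> edge_space ?K"
    using uw t by (auto simp: c2_def edge_space_def axis_def)
  moreover have "c2 \<bullet> cut_vec ?K S = (if k then 1 else 0)"
    if "S \<subseteq> V" "a \<bullet> cut_vec ?K S = a0" for S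
    using eq[OF that] uw t by (auto simp: c2_def inner_add_left inner_axis_edge cut_vec_complete)
  ultimately obtain \<mu>2 where 2: "c2 = \<mu>2 *\<^sub>R a"
    using facet_inducing_hyperplane_unique[OF facet] by metis
  \<comment> \<open>Both vectors are multiples of \<open>a\<close>. The first is nonzero but
    vanishes at \<open>{w, t}\<close>, so \<open>a\<close> vanishes there too, while the second does
    not.\<close>
  have "c1 $ {u, w} = 1" "c1 $ {w, t} = 0" "c2 $ {w, t} = 1"
    using t uw by (auto simp: c1_def c2_def axis_def doubleton_eq_iff)
  then show False using 1 2 by (auto simp: vec_eq_iff)
qed

lemma inner_cut_vec_singleton:
  assumes "a \<in> edge_space (complete_graph V)" "w \<in> V"
  shows "a \<bullet> cut_vec (complete_graph V) {w} = (\<Sum>v\<in>nb a w. a $ {w, v})"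
proof -
  let ?K = "complete_graph V"
  have nb: "v \<in> V" "v \<noteq> w" if "v \<in> nb a w" for v
    using nb_complete[OF assms(1) that] by simp_all
  have "a \<bullet> cut_vec ?K {w} = (\<Sum>e\<in>UNIV. a $ e * cut_vec ?K {w} $ e)"
    by (simp add: inner_vec_def)
  also have "\<dots> = (\<Sum>e\<in>(\<lambda>v. {w, v}) ` nb a w. a $ e)"
  proof (rule sum.mono_neutral_cong_right)
    show "\<forall>e\<in>UNIV - (\<lambda>v. {w, v}) ` nb a w. a $ e * cut_vec ?K {w} $ e = 0"
    proof
      fix e assume e: "e \<in> UNIV - (\<lambda>v. {w, v}) ` nb a w"
      show "a $ e * cut_vec ?K {w} $ e = 0"
      proof (cases "e \<in> edges ?K")
        case True
        then obtain x y where xy: "x \<in> V" "y \<in> V" "x \<noteq> y" "e = {x, y}"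
          using pair_graphE[OF pair_graph_complete True] by auto
        then show ?thesis using e
          by (auto simp: cut_vec_complete nb_def insert_commute)
      qed (simp add: cut_vec_def)
    qed
    show "a $ e * cut_vec ?K {w} $ e = a $ e" if e: "e \<in> (\<lambda>v. {w, v}) ` nb a w" for e
    proof -
      obtain v where v: "v \<in> nb a w" "e = {w, v}" using e by blast
      have "cut_vec ?K {w} $ {w, v} = 1"
        using cut_vec_complete[OF assms(2) nb(1)[OF v(1)] nb(2)[OF v(1), symmetric], of "{w}"] nb(2)[OF v(1)]
        by simp
      then show ?thesis using v by simp
    qed
  qed auto
  also have "\<dots> = (\<Sum>v\<in>nb a w. a $ {w, v})"
    by (subst sum.reindex) (auto simp: inj_on_def doubleton_eq_iff)
  finally show ?thesis .
qed

text \<open>Moving \<open>w\<close> to the other side of a tight cut cannot increase \<open>a \<bullet> x\<close>.\<close>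

lemma tight_cut_flip:
  assumes "tight (complete_graph V) (a, a0)" "a \<in> edge_space (complete_graph V)" "w \<in> V"
    and "S \<subseteq> V" "a \<bullet> cut_vec (complete_graph V) S = a0"
  shows "(\<Sum>v\<in>nb a w. sg S w * sg S v * a $ {w, v}) \<le> 0"
proof -
  let ?K = "complete_graph V"
  \<comment> \<open>Switching along \<open>S\<close> turns the tight cut into the empty cut, and
    moving \<open>w\<close> across it into the cut of the single node \<open>w\<close>.\<close>
  define c where "c = fst (switching ?K S (a, a0))"
  have "c \<in> edge_space ?K" using assms(2) by (simp add: c_def switching_def edge_space_def)
  moreover have w: "w \<notin> nb a w" using nb_complete(3)[OF assms(2), of w w] by auto
  then have c: "c $ {w, v} = sg S w * sg S v * a $ {w, v}" if "v \<noteq> w" for v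
    unfolding c_def using that switching_coeff by metis
  have "w \<notin> nb c w" using nb_complete(3)[OF calculation, of w w] by auto
  then have "v \<in> nb c w \<longleftrightarrow> v \<in> nb a w" for v using c w by (cases "v = w") (auto simp: nb_def sg_def)
  then have "nb c w = nb a w" by blast
  ultimately have "c \<bullet> cut_vec ?K {w} = (\<Sum>v\<in>nb a w. sg S w * sg S v * a $ {w, v})"
    using inner_cut_vec_singleton[of c V w] assms(3) c w by (metis (no_types, lifting) sum.cong)
  moreover have "c \<bullet> cut_vec ?K {w} = a \<bullet> cut_vec ?K (sym_diff {w} S) - a0"
    unfolding c_def cut_vec_switching[OF pair_graph_complete] using assms(5) by simp
  moreover have "sym_diff {w} S \<subseteq> V" using assms(3,4) by blast
  then have "a \<bullet> cut_vec ?K (sym_diff {w} S) \<le> a0"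
    using assms(1) by (simp add: tight_def)
  ultimately show ?thesis by simp
qed

text \<open>Brings the four forms into one affine shape with a coefficient vector supported on the
  triangle, to which uniqueness of the facet hyperplane applies.\<close>

lemma tri_form_linear:
  assumes "\<Delta> \<in> tri_forms u v w"
  obtains c c0 where "\<And>x. \<Delta> x = c \<bullet> x - c0" "\<And>e. e \<notin> {{u, v}, {u, w}, {v, w}} \<Longrightarrow> c $ e = 0"
proof -
  have "\<exists>r s t c0. \<forall>x. \<Delta> x = r * x $ {u, v} + s * x $ {u, w} + t * x $ {v, w} - c0"
    using assms unfolding tri_forms_def
  proof (elim insertE emptyE)
    assume "\<Delta> = tri_minus u v w"
    then show ?thesis
      by (intro exI[of _ 1] exI[of _ "-1"] exI[of _ "-1"] exI[of _ 0]) (simp add: tri_minus_def)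
  next
    assume "\<Delta> = tri_minus w v u"
    then show ?thesis
      by (intro exI[of _ "-1"] exI[of _ "-1"] exI[of _ "1"] exI[of _ 0])
        (simp add: tri_minus_def insert_commute)
  next
    assume "\<Delta> = tri_minus u w v"
    then show ?thesis
      by (intro exI[of _ "-1"] exI[of _ "1"] exI[of _ "-1"] exI[of _ 0])
        (simp add: tri_minus_def insert_commute)
  next
    assume "\<Delta> = tri_plus u v w"
    then show ?thesis
      by (intro exI[of _ 1] exI[of _ "1"] exI[of _ "1"] exI[of _ 2]) (simp add: tri_plus_def)
  qed
  then obtain r s t c0 where *: "\<And>x. \<Delta> x = r * x $ {u, v} + s * x $ {u, w} + t * x $ {v, w} - c0"
    by blast
  show thesis
  proof (rule that)
    show "\<Delta> x = (r *\<^sub>R axis {u, v} 1 + s *\<^sub>R axis {u, w} 1 + t *\<^sub>R axis {v, w} 1) \<bullet> x - c0" for x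
      by (simp add: * inner_add_left inner_axis_edge)
    show "(r *\<^sub>R axis {u, v} 1 + s *\<^sub>R axis {u, w} 1 + t *\<^sub>R axis {v, w} 1) $ e = 0"
      if "e \<notin> {{u, v}, {u, w}, {v, w}}" for e
      using that by (auto simp: axis_def)
  qed
qed

text \<open>By uniqueness of the facet hyperplane the form is a multiple of
  \<open>a \<bullet> x - a0\<close>. What remains is that the factor is positive.\<close>

lemma triangle_inequalityI:
  assumes facet: "facet_inducing (complete_graph V) (a, a0)"
    and V: "u \<in> V" "v \<in> V" "w \<in> V" "u \<noteq> v" "u \<noteq> w" "v \<noteq> w"
    and \<Delta>: "\<Delta> \<in> tri_forms u v w"
    and eq: "\<And>S. S \<subseteq> V \<Longrightarrow> a \<bullet> cut_vec (complete_graph V) S = a0 \<Longrightarrow> \<Delta> (cut_vec (complete_graph V) S) = 0"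
  shows "triangle_inequality (complete_graph V) (a, a0)"
proof -
  let ?K = "complete_graph V"
  obtain c c0 where c: "\<And>x. \<Delta> x = c \<bullet> x - c0" "\<And>e. e \<notin> {{u, v}, {u, w}, {v, w}} \<Longrightarrow> c $ e = 0"
    using tri_form_linear[OF \<Delta>] by metis
  have "{u, v} \<in> edges ?K" "{u, w} \<in> edges ?K" "{v, w} \<in> edges ?K" using V by simp_all
  then have "e \<notin> {{u, v}, {u, w}, {v, w}}" if "e \<notin> edges ?K" for e using that by auto
  then have "c \<in> edge_space ?K" using c(2) by (simp add: edge_space_def)
  moreover have "c \<bullet> cut_vec ?K S = c0" if "S \<subseteq> V" "a \<bullet> cut_vec ?K S = a0" for S
    using eq[OF that] c(1) by simp
  ultimately obtain \<mu> where "c = \<mu> *\<^sub>R a" "c0 = \<mu> * a0"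
    using facet_inducing_hyperplane_unique[OF facet, of c c0] by blast
  then have \<mu>: "\<Delta> x = \<mu> * (a \<bullet> x - a0)" for x by (simp add: c(1) algebra_simps)
  note cuts = cut_vec_complete[OF V(1,2,4)] cut_vec_complete[OF V(1,3,5)] cut_vec_complete[OF V(2,3,6)]
    cut_vec_complete[OF V(2,1) V(4)[symmetric]] cut_vec_complete[OF V(3,1) V(5)[symmetric]]
    cut_vec_complete[OF V(3,2) V(6)[symmetric]]
  \<comment> \<open>Each form takes the value -2 on exactly one of these four cuts and 0 on the
    others. A cut with a negative value fixes the sign of \<open>\<mu>\<close>, as the facet
    inequality is valid on cuts.\<close>
  have "\<exists>S \<in> {{}, {u}, {v}, {w}}. \<Delta> (cut_vec ?K S) < 0"
    using \<Delta> V(4-6) by (auto simp: tri_forms_def tri_minus_def tri_plus_def cuts)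
  then obtain S where "S \<subseteq> V" "\<Delta> (cut_vec ?K S) < 0" using V by auto
  moreover have "a \<bullet> cut_vec ?K S \<le> a0" if "S \<subseteq> V" for S
    using facet_inducing_tight[OF facet] that by (simp add: tight_def)
  ultimately have "\<mu> > 0" unfolding \<mu> by (metis mult_less_0_iff diff_gt_0_iff_gt leD)
  then have "a \<bullet> x - a0 = inverse \<mu> * \<Delta> x" for x by (simp add: \<mu>)
  moreover have "inverse \<mu> > 0" using \<open>\<mu> > 0\<close> by simp
  ultimately have "\<exists>l>0. \<exists>\<Delta>\<in>tri_forms u v w. \<forall>x. a \<bullet> x - a0 = l * \<Delta> x"
    using \<Delta> by blast
  then show ?thesis
    unfolding triangle_inequality_def complete_graph_simps using V by blast
qed

text \<open>In the inequality for moving \<open>w\<close>, a single neighbour or the heavier of two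
  decides the sign, which fixes one coordinate on all tight cuts. Two neighbours of equal weight
  only exclude that both terms are positive, and this is a triangle equation.\<close>

lemma facet_inducing_degree:
  fixes V :: "'v::finite set"
  assumes facet: "facet_inducing (complete_graph V) (a, a0)"
    and not_triangle: "\<not> triangle_inequality (complete_graph V) (a, a0)"
    and V: "card V \<ge> 3" and w: "w \<in> V"
  shows "nb a w = {} \<or> card (nb a w) \<ge> 3"
proof (rule ccontr)
  let ?K = "complete_graph V"
  assume "\<not> ?thesis"
  then have "card (nb a w) = 1 \<or> card (nb a w) = 2"
    using card_gt_0_iff[of "nb a w"] by (auto simp: less_Suc_eq numeral_3_eq_3)
  have aE: "a \<in> edge_space ?K" using facet by (simp add: facet_inducing_def)
  then have nbV: "v \<in> V" "v \<noteq> w" if "v \<in> nb a w" for v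
    using nb_complete[OF aE that] by simp_all
  note flip = tight_cut_flip[OF facet_inducing_tight[OF facet] aE w]
  note hyperplane = facet_not_in_edge_hyperplane[OF facet V _ w]
  from \<open>card (nb a w) = 1 \<or> card (nb a w) = 2\<close> show False
  proof
    assume "card (nb a w) = 1"
    then obtain u where nb: "nb a w = {u}" by (auto simp: card_1_singleton_iff)
    have "a $ {w, u} \<noteq> 0" using nb by (auto simp: nb_def)
    then have "(u \<in> S) \<noteq> (w \<in> S) \<longleftrightarrow> a $ {w, u} > 0"
      if "S \<subseteq> V" "a \<bullet> cut_vec ?K S = a0" for S
      using flip[OF that] nb by (auto simp: sg_def split: if_splits)
    then show False using hyperplane[of u] nbV[of u] nb by auto
  next
    assume "card (nb a w) = 2"
    then obtain u v where nb: "nb a w = {u, v}" and uv: "u \<noteq> v" by (auto simp: card_2_iff)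
    have V': "u \<in> V" "v \<in> V" "u \<noteq> w" "v \<noteq> w" using nb nbV by auto
    have nz: "a $ {w, u} \<noteq> 0" "a $ {w, v} \<noteq> 0" using nb by (auto simp: nb_def)
    have le: "sg S w * sg S u * a $ {w, u} + sg S w * sg S v * a $ {w, v} \<le> 0"
      if "S \<subseteq> V" "a \<bullet> cut_vec ?K S = a0" for S
      using flip[OF that] nb uv by simp
    consider "\<bar>a $ {w, u}\<bar> > \<bar>a $ {w, v}\<bar>" | "\<bar>a $ {w, u}\<bar> < \<bar>a $ {w, v}\<bar>"
      | "\<bar>a $ {w, u}\<bar> = \<bar>a $ {w, v}\<bar>" by linarith
    then show False
    proof cases
      case 1
      then have "(u \<in> S) \<noteq> (w \<in> S) \<longleftrightarrow> a $ {w, u} > 0"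
        if "S \<subseteq> V" "a \<bullet> cut_vec ?K S = a0" for S
        using le[OF that] by (auto simp: sg_def split: if_splits)
      then show False using hyperplane[of u] V' by auto
    next
      case 2
      then have "(v \<in> S) \<noteq> (w \<in> S) \<longleftrightarrow> a $ {w, v} > 0"
        if "S \<subseteq> V" "a \<bullet> cut_vec ?K S = a0" for S
        using le[OF that] by (auto simp: sg_def split: if_splits)
      then show False using hyperplane[of v] V' by auto
    next
      case 3
      \<comment> \<open>Of the four positions of \<open>u\<close> and \<open>v\<close> relative to
        \<open>w\<close>, the one with both terms positive is excluded. The signs of the two
        coefficients select the triangular form that vanishes on the other three.\<close>
      define \<Delta> where "\<Delta> = (if a $ {w, u} > 0
        then if a $ {w, v} > 0 then tri_plus u v w else tri_minus u w v
        else if a $ {w, v} > 0 then tri_minus w v u else tri_minus u v w)"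
      have "\<Delta> \<in> tri_forms u v w" by (simp add: \<Delta>_def tri_forms_def)
      moreover have "\<Delta> (cut_vec ?K S) = 0" if "S \<subseteq> V" "a \<bullet> cut_vec ?K S = a0" for S
      proof -
        have "\<not> (((u \<in> S \<longleftrightarrow> w \<in> S) \<longleftrightarrow> a $ {w, u} > 0) \<and> ((v \<in> S \<longleftrightarrow> w \<in> S) \<longleftrightarrow> a $ {w, v} > 0))"
          using le[OF that] 3 nz by (cases "a $ {w, u} > 0"; cases "a $ {w, v} > 0") (auto simp: sg_def split: if_splits)
        then show ?thesis using V' w uv
          by (cases "a $ {w, u} > 0"; cases "a $ {w, v} > 0")
            (auto simp: \<Delta>_def tri_minus_def tri_plus_def cut_vec_complete)
      qed
      ultimately show False
        using triangle_inequalityI[OF facet V'(1,2) w uv V'(3,4)] not_triangle by blast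
    qed
  qed
qed

section \<open>Coefficients of triangular eliminations\<close>

lemma tri_form_coeff_other:
  assumes "\<Delta> \<in> tri_forms u v w" "e \<notin> {{u, v}, {u, w}, {v, w}}"
  shows "\<Delta> (axis e 1) = \<Delta> 0"
proof -
  have "axis e (1::real) $ {u, v} = 0" "axis e (1::real) $ {u, w} = 0" "axis e (1::real) $ {v, w} = 0"
    using assms(2) by (auto simp: axis_def)
  moreover from this have "axis e (1::real) $ {v, u} = 0" "axis e (1::real) $ {w, u} = 0" "axis e (1::real) $ {w, v} = 0"
    by (simp_all only: insert_commute)
  ultimately show ?thesis
    using assms(1) unfolding tri_forms_def
    by (elim insertE emptyE) (simp_all add: tri_minus_def tri_plus_def)
qed

text \<open>The four forms are exactly the sign patterns on a triangle with product 1, so each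
  coefficient is the product of the other two. Subtracting the value at 0 isolates a coefficient of
  an affine function.\<close>

lemma tri_form_coeffs:
  assumes "\<Delta> \<in> tri_forms u v w" "u \<noteq> v" "u \<noteq> w" "v \<noteq> w"
  shows "\<bar>\<Delta> (axis {u, w} 1) - \<Delta> 0\<bar> = 1" "\<bar>\<Delta> (axis {v, w} 1) - \<Delta> 0\<bar> = 1"
    "(\<Delta> (axis {u, w} 1) - \<Delta> 0) * (\<Delta> (axis {v, w} 1) - \<Delta> 0) = \<Delta> (axis {u, v} 1) - \<Delta> 0"
  using assms by (auto simp: tri_forms_def tri_minus_def tri_plus_def axis_def doubleton_eq_iff)

text \<open>The elimination identity mixes coordinates of both graphs; a cut vector of the complete
  graph on the whole type evaluates all its terms at one point.\<close>

abbreviation "full_cut S \<equiv> cut_vec (complete_graph UNIV) S"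

lemma inner_full_cut:
  assumes "pair_graph G" "a \<in> edge_space G"
  shows "a \<bullet> cut_vec G S = a \<bullet> full_cut S"
  unfolding inner_vec_def
proof (rule sum.cong[OF refl])
  fix e
  show "a $ e \<bullet> cut_vec G S $ e = a $ e \<bullet> full_cut S $ e"
  proof (cases "e \<in> edges G")
    case True
    then have "e \<in> edges (complete_graph UNIV)" using assms(1) by (auto elim!: pair_graphE)
    then show ?thesis using True by (simp add: cut_vec_def)
  qed (use assms(2) in \<open>simp add: edge_space_def\<close>)
qed

lemma full_cut_pair: "u \<noteq> v \<Longrightarrow> full_cut S $ {u, v} = (if (u \<in> S) \<noteq> (v \<in> S) then 1 else 0)"
  by (simp add: cut_vec_complete)

text \<open>A form is nonzero for only one partition of its three nodes, and moving \<open>w\<close>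
  to the other side changes the partition.\<close>

lemma tri_form_full_cut:
  assumes "\<Delta> \<in> tri_forms u v w" "u \<noteq> v" "u \<noteq> w" "v \<noteq> w"
  shows "\<Delta> (full_cut S) \<le> 0" "w \<notin> S \<Longrightarrow> \<Delta> (full_cut S) = 0 \<or> \<Delta> (full_cut (insert w S)) = 0"
  using assms
  by (cases "u \<in> S"; cases "v \<in> S"; auto simp: tri_forms_def tri_minus_def tri_plus_def full_cut_pair)+

lemma tri_form_full_cut_cong:
  assumes "\<Delta> \<in> tri_forms u v w" "u \<noteq> v" "u \<noteq> w" "v \<noteq> w"
    and "u \<in> S \<longleftrightarrow> u \<in> T" "v \<in> S \<longleftrightarrow> v \<in> T" "w \<in> S \<longleftrightarrow> w \<in> T"
  shows "\<Delta> (full_cut S) = \<Delta> (full_cut T)"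
  using assms by (auto simp: tri_forms_def tri_minus_def tri_plus_def full_cut_pair)

text \<open>\<open>N e\<close> is the new node associated with the edge \<open>e\<close>.\<close>

locale bipartite_elim =
  fixes A B :: "'v::finite set" and N :: "'v set \<Rightarrow> 'v"
  assumes disj: "A \<inter> B = {}"
    and N_fresh: "e \<in> edges (complete_graph A) \<union> edges (complete_graph B) \<Longrightarrow> N e \<notin> A \<union> B"
    and N_inj: "inj_on N (edges (complete_graph A) \<union> edges (complete_graph B))"
begin

definition F :: "'v set set" where "F = edges (complete_graph A) \<union> edges (complete_graph B)"
definition X :: "'v set" where "X = A \<union> N ` edges (complete_graph B)"
definition Y :: "'v set" where "Y = B \<union> N ` edges (complete_graph A)"

abbreviation "KV \<equiv> complete_graph (A \<union> B)"
abbreviation "H \<equiv> complete_bipartite X Y"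

lemma F_iff: "{u, v} \<in> F \<longleftrightarrow> u \<noteq> v \<and> (u \<in> A \<and> v \<in> A \<or> u \<in> B \<and> v \<in> B)"
  by (auto simp: F_def)

lemma FE:
  assumes "e \<in> F"
  obtains u v where "e = {u, v}" "u \<noteq> v" "u \<in> A \<union> B" "v \<in> A \<union> B"
  using assms pair_graphE[OF pair_graph_complete] unfolding F_def
  by (metis (no_types, lifting) UnCI UnE complete_graph_simps(1))

lemma F_sub: "e \<in> F \<Longrightarrow> x \<in> e \<Longrightarrow> x \<in> A \<union> B"
  by (erule FE) auto

lemma N_notin: "e \<in> F \<Longrightarrow> N e \<notin> A \<union> B" using N_fresh by (simp add: F_def)

lemma N_eq_iff: "e \<in> F \<Longrightarrow> f \<in> F \<Longrightarrow> N e = N f \<longleftrightarrow> e = f"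
  using N_inj by (auto simp: F_def inj_on_def)

lemma XY_disj: "X \<inter> Y = {}"
proof -
  have "edges (complete_graph A) \<inter> edges (complete_graph B) = {}"
    using disj by (auto simp: complete_graph_def doubleton_eq_iff)
  then have "N ` edges (complete_graph A) \<inter> N ` edges (complete_graph B) = {}"
    using N_inj by (metis inj_on_image_Int image_empty sup_ge1 sup_ge2)
  then show ?thesis using disj N_fresh unfolding X_def Y_def by blast
qed

lemma verts_H: "verts H = A \<union> B \<union> N ` F"
  by (auto simp: complete_bipartite_def X_def Y_def F_def)

lemma verts_H_XY: "verts H = X \<union> Y"
  by (simp add: complete_bipartite_def)

lemma edges_H: "{x, y} \<in> edges H \<longleftrightarrow> x \<in> X \<and> y \<in> Y \<or> x \<in> Y \<and> y \<in> X"
  by (auto simp: complete_bipartite_def doubleton_eq_iff)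

lemma pair_graph_H: "pair_graph H"
  unfolding pair_graph_def
proof
  fix e assume "e \<in> edges H"
  then obtain x y where "x \<in> X" "y \<in> Y" "e = {x, y}" by (auto simp: complete_bipartite_def)
  moreover from this have "x \<noteq> y" using XY_disj by auto
  ultimately show "\<exists>u\<in>verts H. \<exists>v\<in>verts H. u \<noteq> v \<and> e = {u, v}"
    unfolding verts_H_XY by blast
qed

lemma old_sides: "u \<in> A \<union> B \<Longrightarrow> u \<in> X \<longleftrightarrow> u \<in> A" "u \<in> A \<union> B \<Longrightarrow> u \<in> Y \<longleftrightarrow> u \<in> B"
  using disj XY_disj unfolding X_def Y_def by blast+

text \<open>The relation \<open>tri_elim\<close> with the sum indexed by eliminated edges instead of
  ordered triples; \<open>D\<close> is the form chosen for an edge.\<close>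

definition eliminates :: "'v ineq \<Rightarrow> 'v ineq \<Rightarrow> bool" where
  "eliminates = (\<lambda>(a, a0) (a', a0'). a \<in> edge_space KV \<and> a' \<in> edge_space H \<and>
     (\<exists>D. (\<forall>u v. {u, v} \<in> F \<longrightarrow> D {u, v} \<in> tri_forms u v (N {u, v})) \<and>
       (\<forall>x. a' \<bullet> x - a0' = a \<bullet> x - a0 + (\<Sum>e\<in>F. \<bar>a $ e\<bar> * D e x))))"

text \<open>What remains of an elimination when the chosen forms are forgotten: at each new node the
  two coefficients are fixed up to a common sign. Their product is the squared weight times the
  coefficient of \<open>uv\<close> in the form, and the latter is opposite in sign to the
  coefficient of \<open>uv\<close> in \<open>a\<close> because the two must cancel.\<close>

definition elim_coeffs :: "'v evec \<Rightarrow> 'v evec \<Rightarrow> bool" where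
  "elim_coeffs a a' \<longleftrightarrow> a \<in> edge_space KV \<and> a' \<in> edge_space H \<and>
     (\<forall>u\<in>A. \<forall>v\<in>B. a' $ {u, v} = a $ {u, v}) \<and>
     (\<forall>u v. {u, v} \<in> F \<longrightarrow> \<bar>a' $ {u, N {u, v}}\<bar> = \<bar>a $ {u, v}\<bar> \<and>
        a' $ {u, N {u, v}} * a' $ {v, N {u, v}} = - \<bar>a $ {u, v}\<bar> * a $ {u, v}) \<and>
     (\<forall>e\<in>F. \<forall>y. y \<notin> e \<longrightarrow> a' $ {y, N e} = 0)"

lemma eliminates_coeffs:
  assumes "eliminates (a, a0) (a', a0')"
  shows "elim_coeffs a a'"
proof -
  obtain D where aE: "a \<in> edge_space KV" "a' \<in> edge_space H"
    and D: "\<And>u v. {u, v} \<in> F \<Longrightarrow> D {u, v} \<in> tri_forms u v (N {u, v})"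
    and eq: "\<And>x. a' \<bullet> x - a0' = a \<bullet> x - a0 + (\<Sum>e\<in>F. \<bar>a $ e\<bar> * D e x)"
    using assms unfolding eliminates_def by auto
  \<comment> \<open>The coefficient of \<open>e\<close> in the form of \<open>f\<close>. The
    identity of affine functions is compared coefficient by coefficient, at 0 and at unit
    vectors.\<close>
  define d where "d f e = D f (axis e 1) - D f 0" for f e
  have coeff: "a' $ e = a $ e + (\<Sum>f\<in>F. \<bar>a $ f\<bar> * d f e)" for e
    using eq[of "axis e 1"] eq[of 0]
    by (simp add: inner_axis d_def right_diff_distrib sum_subtractf)
  have d0: "d f e = 0" if f: "f \<in> F" and "e \<noteq> f" "\<And>x. x \<in> f \<Longrightarrow> e \<noteq> {x, N f}" for f e
  proof -
    obtain x y where xy: "f = {x, y}" using f by (rule FE)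
    show ?thesis
      using that D[of x y] tri_form_coeff_other[of "D f" x y "N f" e] by (auto simp: xy d_def)
  qed
  have "a' $ {u, v} = a $ {u, v}" if uv: "u \<in> A" "v \<in> B" for u v
  proof -
    have "d f {u, v} = 0" if f: "f \<in> F" for f
    proof (rule d0[OF f])
      show "{u, v} \<noteq> f" using uv f disj F_iff by blast
      show "{u, v} \<noteq> {x, N f}" for x using uv N_notin[OF f] by (auto simp: doubleton_eq_iff)
    qed
    then show ?thesis by (simp add: coeff)
  qed
  moreover have "\<bar>a' $ {u, N {u, v}}\<bar> = \<bar>a $ {u, v}\<bar> \<and>
        a' $ {u, N {u, v}} * a' $ {v, N {u, v}} = - \<bar>a $ {u, v}\<bar> * a $ {u, v}"
    if e: "{u, v} \<in> F" for u v
  proof -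
    let ?e = "{u, v}" and ?w = "N {u, v}"
    have V: "u \<noteq> v" "u \<in> A \<union> B" "v \<in> A \<union> B" using e F_iff by auto
    then have nw: "u \<noteq> ?w" "v \<noteq> ?w" using N_notin[OF e] by auto
    have single: "a' $ g = a $ g + \<bar>a $ ?e\<bar> * d ?e g"
      if "\<And>f. f \<in> F \<Longrightarrow> f \<noteq> ?e \<Longrightarrow> d f g = 0" for g
    proof -
      have "(\<Sum>f\<in>F. \<bar>a $ f\<bar> * d f g) = \<bar>a $ ?e\<bar> * d ?e g"
        using that e by (subst sum.remove[OF _ e]) auto
      then show ?thesis by (simp add: coeff)
    qed
    have new: "a' $ {y, ?w} = \<bar>a $ ?e\<bar> * d ?e {y, ?w}" if y: "y \<in> A \<union> B" for y
    proof -
      have "{y, ?w} \<notin> edges KV" using N_notin[OF e] by simp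
      then have "a $ {y, ?w} = 0" using aE by (simp add: edge_space_def)
      moreover have "d f {y, ?w} = 0" if f: "f \<in> F" "f \<noteq> ?e" for f
      proof (rule d0[OF f(1)])
        show "{y, ?w} \<noteq> f" using F_sub[OF f(1)] N_notin[OF e] by blast
        show "{y, ?w} \<noteq> {x, N f}" for x
          using N_notin[OF f(1)] N_eq_iff[OF e f(1)] f(2) y by (auto simp: doubleton_eq_iff)
      qed
      ultimately show ?thesis using single by simp
    qed
    have "a' $ ?e = a $ ?e + \<bar>a $ ?e\<bar> * d ?e ?e"
    proof (rule single)
      fix f assume f: "f \<in> F" "f \<noteq> ?e"
      show "d f ?e = 0"
      proof (rule d0[OF f(1)])
        show "?e \<noteq> f" using f by simp
        show "?e \<noteq> {x, N f}" for x using N_notin[OF f(1)] V by (auto simp: doubleton_eq_iff)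
      qed
    qed
    \<comment> \<open>The eliminated edge is no edge of the bipartite graph, so the form has to
      cancel its coefficient; this ties the sign of the form to the sign of
      \<open>a\<close>.\<close>
    moreover have "?e \<notin> edges H" using F_iff e disj by (auto simp: edges_H old_sides)
    then have "a' $ ?e = 0" using aE by (simp add: edge_space_def)
    ultimately have de: "\<bar>a $ ?e\<bar> * d ?e ?e = - a $ ?e" by simp
    note c = tri_form_coeffs[OF D[OF e] V(1) nw, folded d_def]
    have "a' $ {u, ?w} * a' $ {v, ?w} = \<bar>a $ ?e\<bar> * (\<bar>a $ ?e\<bar> * (d ?e {u, ?w} * d ?e {v, ?w}))"
      using new V by (simp add: ac_simps)
    then show ?thesis using new[OF V(2)] c de by (simp add: abs_mult)
  qed
  moreover have "a' $ {y, N e} = 0" if e: "e \<in> F" "y \<notin> e" for e y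
  proof -
    have "{y, N e} \<notin> edges KV" using N_notin[OF e(1)] by simp
    then have "a $ {y, N e} = 0" using aE by (simp add: edge_space_def)
    moreover have "d f {y, N e} = 0" if f: "f \<in> F" for f
    proof (rule d0[OF f])
      show "{y, N e} \<noteq> f" using F_sub[OF f] N_notin[OF e(1)] by blast
      show "{y, N e} \<noteq> {x, N f}" if "x \<in> f" for x
        using N_notin[OF e(1)] N_eq_iff[OF e(1) f] e(2) F_sub[OF f that] that by (auto simp: doubleton_eq_iff)
    qed
    ultimately show ?thesis by (simp add: coeff)
  qed
  ultimately show ?thesis using aE unfolding elim_coeffs_def by blast
qed

text \<open>On cuts every triangular form is at most 0, which gives validity. For equality, a tight
  cut of the old nodes is extended by putting each new node on a side where its form
  vanishes.\<close>

lemma eliminates_tight: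
  assumes "eliminates (a, a0) (a', a0')" "tight KV (a, a0)"
  shows "tight H (a', a0')"
proof -
  obtain D where aE: "a \<in> edge_space KV" "a' \<in> edge_space H"
    and D: "\<And>u v. {u, v} \<in> F \<Longrightarrow> D {u, v} \<in> tri_forms u v (N {u, v})"
    and eq: "\<And>x. a' \<bullet> x - a0' = a \<bullet> x - a0 + (\<Sum>e\<in>F. \<bar>a $ e\<bar> * D e x)"
    using assms unfolding eliminates_def by auto
  have nw: "u \<noteq> v" "u \<noteq> N {u, v}" "v \<noteq> N {u, v}" if e: "{u, v} \<in> F" for u v
    using N_notin[OF e] F_iff e by auto
  \<comment> \<open>The coefficients of \<open>a\<close> see only the old nodes of a cut.\<close>
  have restrict: "a \<bullet> full_cut S = a \<bullet> cut_vec KV (S \<inter> (A \<union> B))" for S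
  proof -
    have "cut_vec KV S = cut_vec KV (S \<inter> (A \<union> B))"
    proof (rule vec_eq_iff[THEN iffD2], rule allI)
      fix e
      have "S \<inter> e = S \<inter> (A \<union> B) \<inter> e" if "e \<in> edges KV"
        using that by (auto elim!: pair_graphE[OF pair_graph_complete])
      then show "cut_vec KV S $ e = cut_vec KV (S \<inter> (A \<union> B)) $ e" by (auto simp: cut_vec_def)
    qed
    then show ?thesis using inner_full_cut[OF pair_graph_complete aE(1)] by metis
  qed
  have le: "\<bar>a $ e\<bar> * D e (full_cut S) \<le> 0" if e: "e \<in> F" for e S
  proof -
    obtain u v where "e = {u, v}" using e by (rule FE)
    then have "D e (full_cut S) \<le> 0" using tri_form_full_cut(1)[OF D nw] e by simp
    then show ?thesis by (simp add: mult_nonneg_nonpos)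
  qed
  have "a' \<bullet> cut_vec H S \<le> a0'" for S
  proof -
    have "a \<bullet> full_cut S \<le> a0" using assms(2) unfolding restrict by (simp add: tight_def)
    moreover have "(\<Sum>e\<in>F. \<bar>a $ e\<bar> * D e (full_cut S)) \<le> 0" using le by (intro sum_nonpos) auto
    ultimately show ?thesis using eq[of "full_cut S"] inner_full_cut[OF pair_graph_H aE(2)] by simp
  qed
  moreover
  obtain S0 where S0: "S0 \<subseteq> A \<union> B" "a \<bullet> cut_vec KV S0 = a0" using assms(2) by (auto simp: tight_def)
  \<comment> \<open>A new node joins the cut iff its form vanishes with the node inside; otherwise
    the form vanishes with the node outside.\<close>
  define S where "S = S0 \<union> {N e |e. e \<in> F \<and> D e (full_cut (insert (N e) S0)) = 0}"
  have NS: "N e \<in> S \<longleftrightarrow> D e (full_cut (insert (N e) S0)) = 0" if "e \<in> F" for e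
    using that S0(1) N_notin[OF that] N_eq_iff[OF that] by (auto simp: S_def)
  have SV: "x \<in> S \<longleftrightarrow> x \<in> S0" if "x \<in> A \<union> B" for x using that N_notin by (auto simp: S_def)
  have "D e (full_cut S) = 0" if e: "e \<in> F" for e
  proof -
    obtain u v where uv: "e = {u, v}" "u \<in> A \<union> B" "v \<in> A \<union> B" using e by (rule FE)
    note De = D[OF e[unfolded uv(1)], folded uv(1)]
    note ne = nw[OF e[unfolded uv(1)], folded uv(1)]
    have w: "N e \<notin> S0" using S0(1) N_notin[OF e] by auto
    show ?thesis
    proof (cases "N e \<in> S")
      case True
      have "D e (full_cut S) = D e (full_cut (insert (N e) S0))"
        by (rule tri_form_full_cut_cong[OF De ne]) (use True SV uv ne in auto)
      then show ?thesis using True NS[OF e] by simp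
    next
      case False
      have "D e (full_cut S) = D e (full_cut S0)"
        by (rule tri_form_full_cut_cong[OF De ne]) (use False w SV uv ne in auto)
      then show ?thesis using False NS[OF e] tri_form_full_cut(2)[OF De ne w] by simp
    qed
  qed
  moreover have "S \<inter> (A \<union> B) = S0" using SV S0(1) by auto
  then have "a \<bullet> full_cut S = a0" using S0(2) by (simp add: restrict)
  ultimately have "a' \<bullet> cut_vec H S = a0'"
    using eq[of "full_cut S"] inner_full_cut[OF pair_graph_H aE(2)] by simp
  moreover have "S \<subseteq> verts H" using S0(1) by (auto simp: S_def verts_H)
  ultimately show ?thesis using \<open>\<And>S. a' \<bullet> cut_vec H S \<le> a0'\<close> by (auto simp: tight_def)
qed

end

section \<open>Automorphisms of the complete bipartite graph\<close>

lemma parts_eqI: "P \<subseteq> X \<Longrightarrow> Q \<subseteq> Y \<Longrightarrow> P \<union> Q = X \<union> Y \<Longrightarrow> X \<inter> Y = {} \<Longrightarrow> P = X \<and> Q = Y"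
  by blast

text \<open>Serves to complete a map that is known only on the nodes of positive degree; the
  leftover sets have equal size and are matched arbitrarily.\<close>

lemma extend_to_bij_betw:
  assumes "finite A" "finite A'" "card A = card A'" "H \<subseteq> A" "inj_on \<sigma> H" "\<sigma> ` H \<subseteq> A'"
  obtains \<tau> where "bij_betw \<tau> A A'" "\<And>x. x \<in> H \<Longrightarrow> \<tau> x = \<sigma> x"
proof -
  have "card (A - H) = card (A' - \<sigma> ` H)"
    using assms by (simp add: card_Diff_subset finite_subset card_image)
  then obtain h where h: "bij_betw h (A - H) (A' - \<sigma> ` H)"
    using assms(1,2) finite_same_card_bij[of "A - H" "A' - \<sigma> ` H"] by auto
  let ?\<tau> = "\<lambda>x. if x \<in> H then \<sigma> x else h x"
  have "bij_betw ?\<tau> H (\<sigma> ` H)" using assms(5) by (auto simp: bij_betw_def inj_on_def)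
  moreover have "bij_betw ?\<tau> (A - H) (A' - \<sigma> ` H)"
    using h by (subst bij_betw_cong[where g = h]) auto
  ultimately have "bij_betw ?\<tau> (H \<union> (A - H)) (\<sigma> ` H \<union> (A' - \<sigma> ` H))"
    by (rule bij_betw_combine) auto
  then have "bij_betw ?\<tau> A A'" using assms(4,6) by (simp add: Un_absorb1 Un_Diff_cancel)
  then show thesis by (rule that) auto
qed

lemma nb_signed_eq:
  assumes "pair_graph G" "\<sigma> \<in> automorphisms G" "signed_eq G \<sigma> S a b"
    and "a \<in> edge_space G" "b \<in> edge_space G"
  shows "nb a (\<sigma> y) = \<sigma> ` nb b y"
proof -
  have p: "\<sigma> permutes verts G" using assms by (simp add: automorphisms_def)
  have "\<sigma> z \<in> nb a (\<sigma> y) \<longleftrightarrow> z \<in> nb b y" for z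
  proof (cases "{y, z} \<in> edges G")
    case True
    then have "b $ {y, z} = sg S y * sg S z * a $ {\<sigma> y, \<sigma> z}" using assms(3) by (simp add: signed_eq_def)
    then show ?thesis by (simp add: nb_def sg_def)
  next
    case False
    then have "{\<sigma> y, \<sigma> z} \<notin> edges G" using automorphism_edge_iff[OF assms(1,2), of "{y, z}"] by simp
    then show ?thesis using False assms(4,5) by (simp add: nb_def edge_space_def)
  qed
  then have "\<sigma> -` nb a (\<sigma> y) = nb b y" by auto
  then show ?thesis using surj_image_vimage_eq[OF permutes_surj[OF p], of "nb a (\<sigma> y)"] by simp
qed

section \<open>Degrees after elimination and the action of automorphisms on old nodes\<close>

context bipartite_elim
begin

lemma elim_coeffsD:
  assumes "elim_coeffs a a'"
  shows "a \<in> edge_space KV" "a' \<in> edge_space H"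
    "u \<in> A \<Longrightarrow> v \<in> B \<Longrightarrow> a' $ {u, v} = a $ {u, v}"
    "u \<in> B \<Longrightarrow> v \<in> A \<Longrightarrow> a' $ {u, v} = a $ {u, v}"
    "{u, v} \<in> F \<Longrightarrow> \<bar>a' $ {u, N {u, v}}\<bar> = \<bar>a $ {u, v}\<bar>"
    "{u, v} \<in> F \<Longrightarrow> a' $ {u, N {u, v}} * a' $ {v, N {u, v}} = - \<bar>a $ {u, v}\<bar> * a $ {u, v}"
    "e \<in> F \<Longrightarrow> y \<notin> e \<Longrightarrow> a' $ {y, N e} = 0"
proof -
  show "a \<in> edge_space KV" "a' \<in> edge_space H"
    "{u, v} \<in> F \<Longrightarrow> \<bar>a' $ {u, N {u, v}}\<bar> = \<bar>a $ {u, v}\<bar>"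
    "{u, v} \<in> F \<Longrightarrow> a' $ {u, N {u, v}} * a' $ {v, N {u, v}} = - \<bar>a $ {u, v}\<bar> * a $ {u, v}"
    "e \<in> F \<Longrightarrow> y \<notin> e \<Longrightarrow> a' $ {y, N e} = 0"
    using assms unfolding elim_coeffs_def by blast+
  have AB: "a' $ {u, v} = a $ {u, v}" if "u \<in> A" "v \<in> B" for u v
    using assms that unfolding elim_coeffs_def by blast
  then show "u \<in> A \<Longrightarrow> v \<in> B \<Longrightarrow> a' $ {u, v} = a $ {u, v}" .
  show "u \<in> B \<Longrightarrow> v \<in> A \<Longrightarrow> a' $ {u, v} = a $ {u, v}"
    using AB[of v u] by (simp add: insert_commute)
qed

lemma nb_new_node:
  assumes "elim_coeffs a a'" "e \<in> F"
  shows "nb a' (N e) = (if a $ e = 0 then {} else e)"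
proof -
  have "y \<in> nb a' (N e) \<longleftrightarrow> a $ e \<noteq> 0" if y: "y \<in> e" for y
  proof -
    obtain z where "e = {y, z}" using y by (rule_tac FE[OF assms(2)]) auto
    then have "\<bar>a' $ {y, N e}\<bar> = \<bar>a $ e\<bar>" using elim_coeffsD(5)[OF assms(1), of y z] assms(2) by simp
    then show ?thesis by (auto simp: nb_def insert_commute)
  qed
  moreover have "y \<notin> nb a' (N e)" if "y \<notin> e" for y
    using elim_coeffsD(7)[OF assms that] by (simp add: nb_def insert_commute)
  ultimately show ?thesis by auto
qed

lemma card_nb_new_node:
  assumes "elim_coeffs a a'" "e \<in> F"
  shows "card (nb a' (N e)) \<le> 2"
proof -
  obtain u v where "e = {u, v}" using assms(2) by (rule FE)
  then show ?thesis using nb_new_node[OF assms] by (simp add: card_insert_if)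
qed

lemma card_nb_old_node:
  assumes c: "elim_coeffs a a'" and u: "u \<in> A \<union> B"
  shows "card (nb a' u) = card (nb a u)"
proof -
  \<comment> \<open>Elimination redirects an eliminated edge at \<open>u\<close> to the new node of
    that edge and keeps the other edges, so \<open>g\<close> carries the old neighbours of
    \<open>u\<close> to the new ones.\<close>
  define g where "g v = (if {u, v} \<in> F then N {u, v} else v)" for v
  note aE = elim_coeffsD(1,2)[OF c]
  have nbV: "v \<in> A \<union> B" "v \<noteq> u" if "v \<in> nb a u" for v using nb_complete[OF aE(1) that] by auto
  have "nb a' u = g ` nb a u"
  proof
    show "g ` nb a u \<subseteq> nb a' u"
    proof (rule image_subsetI)
      fix v assume v: "v \<in> nb a u"
      show "g v \<in> nb a' u"
      proof (cases "{u, v} \<in> F")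
        case True
        then show ?thesis using elim_coeffsD(5)[OF c True] v by (auto simp: g_def nb_def)
      next
        case False
        then have "u \<in> A \<and> v \<in> B \<or> u \<in> B \<and> v \<in> A" using u nbV[OF v] by (auto simp: F_iff)
        then have "a' $ {u, v} = a $ {u, v}" using elim_coeffsD(3,4)[OF c] by auto
        then show ?thesis using v False by (simp add: g_def nb_def)
      qed
    qed
    show "nb a' u \<subseteq> g ` nb a u"
    proof
      fix y assume y: "y \<in> nb a' u"
      have edge: "{u, y} \<in> edges H" using nb_edge[OF aE(2) y] .
      then have "y \<in> verts H" using pair_graph_edgeD(2)[OF pair_graph_H] by blast
      then consider "y \<in> A \<union> B" | e where "e \<in> F" "y = N e" unfolding verts_H by blast
      then show "y \<in> g ` nb a u"
      proof cases
        case 1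
        have *: "u \<in> A \<and> y \<in> B \<or> u \<in> B \<and> y \<in> A"
          using edge 1 u by (auto simp: edges_H old_sides)
        then have "a' $ {u, y} = a $ {u, y}" using elim_coeffsD(3,4)[OF c] by auto
        moreover have "{u, y} \<notin> F" using * disj by (auto simp: F_iff)
        ultimately show ?thesis using y by (intro image_eqI[of _ _ y]) (auto simp: g_def nb_def)
      next
        case 2
        have "u \<in> e" using y elim_coeffsD(7)[OF c 2(1)] by (auto simp: nb_def 2)
        then obtain z where z: "e = {u, z}" by (rule_tac FE[OF 2(1)]) auto
        have "z \<in> nb a u" using elim_coeffsD(5)[OF c, of u z] y 2 z by (auto simp: nb_def)
        then show ?thesis using 2 z by (intro image_eqI[of _ _ z]) (auto simp: g_def)
      qed
    qed
  qed
  moreover have "inj_on g (nb a u)"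
  proof (rule inj_onI)
    fix v v' assume v: "v \<in> nb a u" "v' \<in> nb a u" "g v = g v'"
    show "v = v'"
      using v(3) nbV[OF v(1)] nbV[OF v(2)] N_notin[of "{u, v}"] N_notin[of "{u, v'}"]
        N_eq_iff[of "{u, v}" "{u, v'}"]
      by (auto simp: g_def doubleton_eq_iff split: if_splits)
  qed
  ultimately show ?thesis by (simp add: card_image)
qed

text \<open>Being on the same side is the same as being nonadjacent, so the image of one node of
  \<open>X\<close> decides where both sides go.\<close>

lemma automorphism_sides:
  assumes "\<sigma> \<in> automorphisms H"
  shows "\<sigma> ` X = X \<and> \<sigma> ` Y = Y \<or> \<sigma> ` X = Y \<and> \<sigma> ` Y = X"
proof -
  have p: "\<sigma> permutes X \<union> Y" using assms by (simp add: automorphisms_def verts_H_XY)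
  then have inj: "inj \<sigma>" by (rule permutes_inj)
  have im: "\<sigma> ` X \<union> \<sigma> ` Y = X \<union> Y" using permutes_image[OF p] by (simp add: image_Un)
  have edge: "{\<sigma> x, \<sigma> y} \<in> edges H \<longleftrightarrow> {x, y} \<in> edges H" for x y
    using automorphism_edge_iff[OF pair_graph_H assms, of "{x, y}"] by simp
  show ?thesis
  proof (cases "X = {}")
    case True
    then show ?thesis using im by simp
  next
    case False
    then obtain x0 where x0: "x0 \<in> X" by auto
    have V: "\<sigma> x \<in> X \<union> Y" if "x \<in> X \<union> Y" for x using that im by blast
    consider "\<sigma> x0 \<in> X" | "\<sigma> x0 \<in> Y" using x0 V by blast
    then show ?thesis
    proof cases
      case 1
      have "\<sigma> ` X \<subseteq> X"
      proof (rule image_subsetI)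
        fix x assume x: "x \<in> X"
        have "{x0, x} \<notin> edges H" using x x0 XY_disj by (auto simp: edges_H)
        then show "\<sigma> x \<in> X" using edge[of x0 x] 1 V[of x] x by (auto simp: edges_H)
      qed
      moreover have "\<sigma> ` Y \<subseteq> Y"
      proof (rule image_subsetI)
        fix y assume y: "y \<in> Y"
        have "{x0, y} \<in> edges H" using y x0 by (auto simp: edges_H)
        then show "\<sigma> y \<in> Y" using edge[of x0 y] 1 XY_disj by (auto simp: edges_H)
      qed
      ultimately show ?thesis using parts_eqI[of "\<sigma> ` X" X "\<sigma> ` Y" Y] im XY_disj by simp
    next
      case 2
      have "\<sigma> ` X \<subseteq> Y"
      proof (rule image_subsetI)
        fix x assume x: "x \<in> X"
        have "{x0, x} \<notin> edges H" using x x0 XY_disj by (auto simp: edges_H)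
        then show "\<sigma> x \<in> Y" using edge[of x0 x] 2 V[of x] x by (auto simp: edges_H)
      qed
      moreover have "\<sigma> ` Y \<subseteq> X"
      proof (rule image_subsetI)
        fix y assume y: "y \<in> Y"
        have "{x0, y} \<in> edges H" using y x0 by (auto simp: edges_H)
        then show "\<sigma> y \<in> X" using edge[of x0 y] 2 XY_disj by (auto simp: edges_H)
      qed
      ultimately show ?thesis using parts_eqI[of "\<sigma> ` Y" X "\<sigma> ` X" Y] im XY_disj by (simp add: Un_commute)
    qed
  qed
qed

definition large_degree :: "'v evec \<Rightarrow> bool" where
  "large_degree a \<longleftrightarrow> (\<forall>u\<in>A \<union> B. nb a u = {} \<or> card (nb a u) \<ge> 3)"

lemma automorphism_old_node:
  assumes c: "elim_coeffs a a'" "elim_coeffs b b'" and deg: "large_degree b"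
    and \<sigma>: "\<sigma> \<in> automorphisms H" "signed_eq H \<sigma> S a' b'"
    and u: "u \<in> A \<union> B" "nb b u \<noteq> {}"
  shows "\<sigma> u \<in> A \<union> B" "nb a (\<sigma> u) \<noteq> {}"
proof -
  have p: "\<sigma> permutes verts H" using \<sigma> by (simp add: automorphisms_def)
  have "card (nb a' (\<sigma> u)) = card (nb b' u)"
    unfolding nb_signed_eq[OF pair_graph_H \<sigma> elim_coeffsD(2)[OF c(1)] elim_coeffsD(2)[OF c(2)]]
    by (intro card_image inj_on_subset[OF permutes_inj[OF p]]) simp
  also have "\<dots> \<ge> 3" using deg u card_nb_old_node[OF c(2) u(1)] by (auto simp: large_degree_def)
  finally have ge: "card (nb a' (\<sigma> u)) \<ge> 3" .
  have "u \<in> verts H" using u(1) unfolding verts_H by blast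
  then have "\<sigma> u \<in> verts H" using permutes_in_image[OF p] by blast
  moreover have "\<sigma> u \<noteq> N e" if "e \<in> F" for e
    using card_nb_new_node[OF c(1) that] ge by auto
  ultimately show *: "\<sigma> u \<in> A \<union> B" unfolding verts_H by blast
  show "nb a (\<sigma> u) \<noteq> {}" using card_nb_old_node[OF c(1) *] ge by auto
qed

text \<open>The new node \<open>N {u, v}\<close> has degree 2, so an automorphism maps it to a node of degree 2, that
  is, to the new node of another edge; its neighbours are the ends of that edge.\<close>

lemma signed_eq_old_edge:
  assumes c: "elim_coeffs a a'" "elim_coeffs b b'" and deg: "large_degree a" "large_degree b"
    and \<sigma>: "\<sigma> \<in> automorphisms H" "signed_eq H \<sigma> S a' b'"
    and uv: "b $ {u, v} \<noteq> 0"
  shows "b $ {u, v} = sg S u * sg S v * a $ {\<sigma> u, \<sigma> v}"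
proof -
  have p: "\<sigma> permutes verts H" using \<sigma> by (simp add: automorphisms_def)
  have nbs: "v \<in> nb b u" "u \<in> nb b v" using uv by (auto simp: nb_def insert_commute)
  note uvV = nb_complete[OF elim_coeffsD(1)[OF c(2)] nbs(1)]
  have \<sigma>V: "\<sigma> u \<in> A \<union> B" "\<sigma> v \<in> A \<union> B"
    using automorphism_old_node(1)[OF c deg(2) \<sigma>] uvV nbs by blast+
  have S: "b' $ {x, y} = sg S x * sg S y * a' $ {\<sigma> x, \<sigma> y}" if "{x, y} \<in> edges H" for x y
    using \<sigma>(2) that by (simp add: signed_eq_def)
  show ?thesis
  proof (cases "{u, v} \<in> F")
    case False
    then have sides: "u \<in> A \<and> v \<in> B \<or> u \<in> B \<and> v \<in> A" using uvV by (auto simp: F_iff)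
    then have edge: "{u, v} \<in> edges H" using uvV by (auto simp: edges_H old_sides)
    then have "{\<sigma> u, \<sigma> v} \<in> edges H"
      using automorphism_edge_iff[OF pair_graph_H \<sigma>(1), of "{u, v}"] by simp
    then have "\<sigma> u \<in> A \<and> \<sigma> v \<in> B \<or> \<sigma> u \<in> B \<and> \<sigma> v \<in> A"
      using \<sigma>V by (auto simp: edges_H old_sides)
    then have "a' $ {\<sigma> u, \<sigma> v} = a $ {\<sigma> u, \<sigma> v}" using elim_coeffsD(3,4)[OF c(1)] by blast
    moreover have "b' $ {u, v} = b $ {u, v}" using sides elim_coeffsD(3,4)[OF c(2)] by blast
    ultimately show ?thesis using S[OF edge] by simp
  next
    case True
    let ?w = "N {u, v}"
    have nbw: "nb b' ?w = {u, v}" using nb_new_node[OF c(2) True] uv by simp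
    have nbw': "nb a' (\<sigma> ?w) = {\<sigma> u, \<sigma> v}"
      using nb_signed_eq[OF pair_graph_H \<sigma> elim_coeffsD(2)[OF c(1)] elim_coeffsD(2)[OF c(2)], of ?w]
      by (simp add: nbw)
    moreover have "\<sigma> u \<noteq> \<sigma> v" using uvV(3) permutes_inj[OF p] by (metis injD)
    ultimately have card: "card (nb a' (\<sigma> ?w)) = 2" by simp
    \<comment> \<open>An old node keeps its degree, which cannot be exactly 2.\<close>
    have "\<sigma> ?w \<notin> A \<union> B"
    proof
      assume w: "\<sigma> ?w \<in> A \<union> B"
      then have "card (nb a (\<sigma> ?w)) = 2" using card_nb_old_node[OF c(1)] card by simp
      moreover have "nb a (\<sigma> ?w) = {} \<or> card (nb a (\<sigma> ?w)) \<ge> 3"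
        using deg(1) w unfolding large_degree_def by blast
      ultimately show False by auto
    qed
    moreover have "?w \<in> verts H" using True unfolding verts_H by blast
    then have "\<sigma> ?w \<in> verts H" using permutes_in_image[OF p] by blast
    ultimately obtain e where e: "e \<in> F" "\<sigma> ?w = N e" unfolding verts_H by blast
    have ae: "e = {\<sigma> u, \<sigma> v}" using nb_new_node[OF c(1) e(1)] nbw' e(2) by (auto split: if_splits)
    have "{u, ?w} \<in> edges H" "{v, ?w} \<in> edges H"
      using nb_edge[OF elim_coeffsD(2)[OF c(2)], of _ ?w] nbw by (auto simp: insert_commute)
    then have 1: "b' $ {u, ?w} = sg S u * sg S ?w * a' $ {\<sigma> u, N e}"
      and 2: "b' $ {v, ?w} = sg S v * sg S ?w * a' $ {\<sigma> v, N e}"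
      using S e(2) by auto
    have prod: "b' $ {u, ?w} * b' $ {v, ?w} = - \<bar>b $ {u, v}\<bar> * b $ {u, v}"
      using elim_coeffsD(6)[OF c(2) True] .
    have prod': "a' $ {\<sigma> u, N e} * a' $ {\<sigma> v, N e} = - \<bar>a $ e\<bar> * a $ e"
      using elim_coeffsD(6)[OF c(1), of "\<sigma> u" "\<sigma> v"] e(1) ae by simp
    have "\<bar>b $ {u, v}\<bar> = \<bar>b' $ {u, ?w}\<bar>" using elim_coeffsD(5)[OF c(2) True] by simp
    also have "\<dots> = \<bar>a' $ {\<sigma> u, N e}\<bar>" by (simp add: 1 abs_mult)
    also have "\<dots> = \<bar>a $ e\<bar>" using elim_coeffsD(5)[OF c(1), of "\<sigma> u" "\<sigma> v"] e(1) ae by simp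
    finally have abs: "\<bar>b $ {u, v}\<bar> = \<bar>a $ e\<bar>" .
    \<comment> \<open>The sign of the new node enters both coefficients and cancels in their
      product, leaving only the signs of \<open>u\<close> and \<open>v\<close>.\<close>
    have "b' $ {u, ?w} * b' $ {v, ?w} = sg S u * sg S v * (a' $ {\<sigma> u, N e} * a' $ {\<sigma> v, N e})"
      unfolding 1 2 by (simp add: sg_def)
    then have "\<bar>b $ {u, v}\<bar> * b $ {u, v} = sg S u * sg S v * (\<bar>a $ e\<bar> * a $ e)"
      unfolding prod prod' by simp
    then have "\<bar>b $ {u, v}\<bar> * b $ {u, v} = \<bar>b $ {u, v}\<bar> * (sg S u * sg S v * a $ e)"
      unfolding abs by (simp only: ac_simps)
    then show ?thesis using uv ae by simp
  qed
qed

section \<open>Passing signed relabellings from one graph to the other\<close>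

definition side_permutation :: "('v \<Rightarrow> 'v) \<Rightarrow> bool" where
  "side_permutation \<tau> \<longleftrightarrow> \<tau> permutes (A \<union> B) \<and> (\<tau> ` A = A \<and> \<tau> ` B = B \<or> \<tau> ` A = B \<and> \<tau> ` B = A)"

text \<open>The old nodes of positive degree determine \<open>\<tau>\<close>; the other old nodes of
  each side are matched arbitrarily. When \<open>\<sigma>\<close> exchanges the sides this needs
  equally many old nodes on both, which \<open>card\<close> supplies.\<close>

lemma signed_eq_restrict:
  assumes c: "elim_coeffs a a'" "elim_coeffs b b'" and deg: "large_degree a" "large_degree b"
    and \<sigma>: "\<sigma> \<in> automorphisms H" "signed_eq H \<sigma> S a' b'"
    and card: "card X = card Y \<Longrightarrow> card A = card B"
  shows "\<exists>\<tau>. side_permutation \<tau> \<and> signed_eq KV \<tau> S a b"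
proof -
  have p: "\<sigma> permutes verts H" using \<sigma> by (simp add: automorphisms_def)
  define Hb where "Hb = {u \<in> A \<union> B. nb b u \<noteq> {}}"
  note old = automorphism_old_node[OF c deg(2) \<sigma>]
  have Hb: "\<sigma> u \<in> A \<union> B" if "u \<in> Hb" for u using old that by (auto simp: Hb_def)
  have inv_aut: "inv \<sigma> \<in> automorphisms H" using automorphism_inv[OF pair_graph_H \<sigma>(1)] .
  have inv_eq: "signed_eq H (inv \<sigma>) (\<sigma> ` S) b' a'" using signed_eq_inv[OF pair_graph_H \<sigma>] .
  have inj: "inj_on \<sigma> Z" for Z using permutes_inj[OF p] inj_on_subset by blast
  obtain \<tau>0 A' B' where \<tau>0: "bij_betw \<tau>0 A A'" "bij_betw \<tau>0 B B'" "A' = A \<and> B' = B \<or> A' = B \<and> B' = A"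
    "\<And>u. u \<in> Hb \<Longrightarrow> \<tau>0 u = \<sigma> u"
  proof -
    obtain A' B' where AB': "A' = A \<and> B' = B \<or> A' = B \<and> B' = A" "card A = card A'" "card B = card B'"
      "\<sigma> ` (Hb \<inter> A) \<subseteq> A'" "\<sigma> ` (Hb \<inter> B) \<subseteq> B'"
    proof (cases "\<sigma> ` X = X \<and> \<sigma> ` Y = Y")
      case True
      have "\<sigma> ` (Hb \<inter> A) \<subseteq> A" "\<sigma> ` (Hb \<inter> B) \<subseteq> B"
        using True Hb old_sides by blast+
      then show ?thesis by (intro that[of A B]) simp_all
    next
      case False
      then have sw: "\<sigma> ` X = Y \<and> \<sigma> ` Y = X" using automorphism_sides[OF \<sigma>(1)] by blast
      then have "card X = card Y" using card_image[OF inj, of X] by simp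
      then have "card A = card B" by (rule card)
      moreover have "\<sigma> ` (Hb \<inter> A) \<subseteq> B" "\<sigma> ` (Hb \<inter> B) \<subseteq> A"
        using sw Hb old_sides by blast+
      ultimately show ?thesis by (intro that[of B A]) simp_all
    qed
    obtain \<tau>A where \<tau>A: "bij_betw \<tau>A A A'" "\<And>x. x \<in> Hb \<inter> A \<Longrightarrow> \<tau>A x = \<sigma> x"
      by (rule extend_to_bij_betw[of A A' "Hb \<inter> A" \<sigma>]) (use AB' inj in auto)
    obtain \<tau>B where \<tau>B: "bij_betw \<tau>B B B'" "\<And>x. x \<in> Hb \<inter> B \<Longrightarrow> \<tau>B x = \<sigma> x"
      by (rule extend_to_bij_betw[of B B' "Hb \<inter> B" \<sigma>]) (use AB' inj in auto)
    let ?\<tau> = "\<lambda>x. if x \<in> A then \<tau>A x else \<tau>B x"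
    have "bij_betw ?\<tau> A A'" using \<tau>A(1) by (subst bij_betw_cong[where g = \<tau>A]) auto
    moreover have "bij_betw ?\<tau> B B'" using \<tau>B(1) disj by (subst bij_betw_cong[where g = \<tau>B]) auto
    moreover have "?\<tau> u = \<sigma> u" if "u \<in> Hb" for u using that \<tau>A(2) \<tau>B(2) by (auto simp: Hb_def)
    ultimately show thesis using AB'(1) by (intro that[of ?\<tau> A' B']) simp_all
  qed
  define \<tau> where "\<tau> x = (if x \<in> A \<union> B then \<tau>0 x else x)" for x
  have \<tau>im: "\<tau> ` A = A'" "\<tau> ` B = B'" using \<tau>0(1,2) by (auto simp: \<tau>_def bij_betw_def)
  have "bij_betw \<tau>0 (A \<union> B) (A' \<union> B')"
    using \<tau>0(1-3) disj by (intro bij_betw_combine) auto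
  then have "bij_betw \<tau> (A \<union> B) (A' \<union> B')" by (subst bij_betw_cong[where g = \<tau>0]) (auto simp: \<tau>_def)
  moreover have "A' \<union> B' = A \<union> B" using \<tau>0(3) by auto
  ultimately have \<tau>p: "\<tau> permutes (A \<union> B)" by (intro bij_imp_permutes) (auto simp: \<tau>_def)
  have \<tau>\<sigma>: "\<tau> u = \<sigma> u" if "u \<in> Hb" for u using that \<tau>0(4) by (auto simp: \<tau>_def Hb_def)
  have "b $ {u, v} = sg S u * sg S v * a $ {\<tau> u, \<tau> v}" if uv: "{u, v} \<in> edges KV" for u v
  proof (cases "b $ {u, v} = 0")
    case False
    then have "u \<in> Hb" "v \<in> Hb" using uv by (auto simp: Hb_def nb_def insert_commute)
    then show ?thesis using signed_eq_old_edge[OF c deg \<sigma> False] \<tau>\<sigma> by simp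
  next
    case True
    have "a $ {\<tau> u, \<tau> v} = 0"
    proof (rule ccontr)
      assume nz: "a $ {\<tau> u, \<tau> v} \<noteq> 0"
      \<comment> \<open>If \<open>a\<close> has positive degree at \<open>\<tau> x\<close>, the
        inverse automorphism leads into \<open>Hb\<close>, where \<open>\<tau>\<close> and
        \<open>\<sigma>\<close> agree. So a nonzero coefficient of \<open>a\<close> pulls back to a
        nonzero coefficient of \<open>b\<close>.\<close>
      have inv\<tau>: "inv \<sigma> (\<tau> x) = x" if x: "x \<in> A \<union> B" "nb a (\<tau> x) \<noteq> {}" for x
      proof -
        have "\<tau> x \<in> A \<union> B" using permutes_in_image[OF \<tau>p] x(1) by blast
        then have "inv \<sigma> (\<tau> x) \<in> Hb"
          using automorphism_old_node[OF c(2,1) deg(1) inv_aut inv_eq _ x(2)] by (simp add: Hb_def)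
        then have "\<tau> (inv \<sigma> (\<tau> x)) = \<tau> x" using \<tau>\<sigma> p by (simp add: permutes_inverses)
        then show ?thesis using permutes_inj[OF \<tau>p] by (metis injD)
      qed
      have "\<tau> v \<in> nb a (\<tau> u)" "\<tau> u \<in> nb a (\<tau> v)" using nz by (auto simp: nb_def insert_commute)
      then have "inv \<sigma> (\<tau> u) = u" "inv \<sigma> (\<tau> v) = v" using inv\<tau> uv by auto
      then have "a $ {\<tau> u, \<tau> v} = 0"
        using signed_eq_old_edge[OF c(2,1) deg(2,1) inv_aut inv_eq nz] True by simp
      then show False using nz by simp
    qed
    then show ?thesis using True by simp
  qed
  then have "signed_eq KV \<tau> S a b" by (simp add: signed_eq_def)
  moreover have "side_permutation \<tau>" using \<tau>p \<tau>im \<tau>0(3) by (auto simp: side_permutation_def)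
  ultimately show ?thesis by blast
qed

lemma automorphism_HI:
  assumes p: "\<sigma> permutes X \<union> Y"
    and sides: "\<sigma> ` X \<subseteq> X \<and> \<sigma> ` Y \<subseteq> Y \<or> \<sigma> ` X \<subseteq> Y \<and> \<sigma> ` Y \<subseteq> X"
  shows "\<sigma> \<in> automorphisms H"
proof -
  have "(\<forall>x\<in>X \<union> Y. (\<sigma> x \<in> X \<longleftrightarrow> x \<in> X) \<and> (\<sigma> x \<in> Y \<longleftrightarrow> x \<in> Y)) \<or>
    (\<forall>x\<in>X \<union> Y. (\<sigma> x \<in> X \<longleftrightarrow> x \<in> Y) \<and> (\<sigma> x \<in> Y \<longleftrightarrow> x \<in> X))"
    using sides
  proof (elim disjE conjE)
    assume "\<sigma> ` X \<subseteq> X" "\<sigma> ` Y \<subseteq> Y"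
    then show ?thesis using XY_disj by (intro disjI1) blast
  next
    assume "\<sigma> ` X \<subseteq> Y" "\<sigma> ` Y \<subseteq> X"
    then show ?thesis using XY_disj by (intro disjI2) blast
  qed
  then have "{u, v} \<in> edges H \<longleftrightarrow> {\<sigma> u, \<sigma> v} \<in> edges H" if "u \<in> X \<union> Y" "v \<in> X \<union> Y" for u v
    using that unfolding edges_H by (elim disjE) auto
  then show ?thesis using p unfolding automorphisms_def verts_H_XY by blast
qed

text \<open>The new node of an edge is sent to the new node of the image edge. Coefficients at a new
  node then match up to a common sign, which is corrected by switching that node.\<close>

lemma signed_eq_extend:
  assumes c: "elim_coeffs a a'" "elim_coeffs b b'"
    and \<tau>: "side_permutation \<tau>" "signed_eq KV \<tau> S a b"
  shows "\<exists>\<sigma>\<in>automorphisms H. \<exists>T. signed_eq H \<sigma> T a' b'"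
proof -
  have p: "\<tau> permutes (A \<union> B)" and sides: "\<tau> ` A = A \<and> \<tau> ` B = B \<or> \<tau> ` A = B \<and> \<tau> ` B = A"
    using \<tau>(1) by (auto simp: side_permutation_def)
  have inj: "\<tau> x = \<tau> y \<longleftrightarrow> x = y" for x y using permutes_inj[OF p] by (metis injD)
  have image_edges: "\<tau> ` e \<in> edges (complete_graph (\<tau> ` Z))" if e: "e \<in> edges (complete_graph Z)" for e Z
  proof -
    obtain x y where "x \<in> Z" "y \<in> Z" "x \<noteq> y" "e = {x, y}"
      using pair_graphE[OF pair_graph_complete e] by auto
    then show ?thesis using inj by simp
  qed
  have \<tau>F: "\<tau> ` e \<in> F" if "e \<in> F" for e
    using image_edges[of e A] image_edges[of e B] that sides by (auto simp: F_def)
  define \<sigma> where "\<sigma> x = (if x \<in> A \<union> B then \<tau> x else if x \<in> N ` F then N (\<tau> ` inv_into F N x) else x)" for x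
  have \<sigma>V: "\<sigma> x = \<tau> x" if "x \<in> A \<union> B" for x using that by (simp add: \<sigma>_def)
  have NF: "inj_on N F" using N_inj by (simp add: F_def)
  have \<sigma>N: "\<sigma> (N e) = N (\<tau> ` e)" if "e \<in> F" for e
    using that N_notin[OF that] inv_into_f_f[OF NF that] by (simp add: \<sigma>_def)
  have \<tau>V: "\<tau> x \<in> A \<union> B" if "x \<in> A \<union> B" for x using that permutes_in_image[OF p] by blast
  have "\<sigma> ` A = \<tau> ` A" "\<sigma> ` B = \<tau> ` B" using \<sigma>V by auto
  moreover have "\<sigma> ` N ` edges (complete_graph Z) \<subseteq> N ` edges (complete_graph (\<tau> ` Z))" if "Z = A \<or> Z = B" for Z
    using \<sigma>N image_edges that by (auto simp: F_def)
  ultimately have \<sigma>sides: "\<sigma> ` X \<subseteq> X \<and> \<sigma> ` Y \<subseteq> Y \<or> \<sigma> ` X \<subseteq> Y \<and> \<sigma> ` Y \<subseteq> X"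
    using sides unfolding X_def Y_def image_Un
    by (elim disjE conjE) (metis Un_mono order_refl)+
  have "inj_on \<sigma> (A \<union> B \<union> N ` F)"
  proof (rule inj_onI)
    fix x y assume "x \<in> A \<union> B \<union> N ` F" "y \<in> A \<union> B \<union> N ` F" and eq: "\<sigma> x = \<sigma> y"
    then consider "x \<in> A \<union> B" "y \<in> A \<union> B" | e where "x \<in> A \<union> B" "y = N e" "e \<in> F"
      | e where "y \<in> A \<union> B" "x = N e" "e \<in> F" | e f where "x = N e" "y = N f" "e \<in> F" "f \<in> F"
      by blast
    then show "x = y"
    proof cases
      case 1
      then show ?thesis using eq inj \<sigma>V by auto
    next
      case 2
      then show ?thesis using eq \<sigma>V \<sigma>N \<tau>V \<tau>F N_notin by metis
    next
      case 3
      then show ?thesis using eq \<sigma>V \<sigma>N \<tau>V \<tau>F N_notin by metis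
    next
      case 4
      then have "\<tau> ` e = \<tau> ` f" using eq \<sigma>N \<tau>F N_eq_iff by metis
      then show ?thesis using 4 inj_image_eq_iff[OF permutes_inj[OF p]] by simp
    qed
  qed
  moreover have XY: "X \<union> Y = A \<union> B \<union> N ` F" using verts_H verts_H_XY by simp
  moreover have "\<sigma> ` (X \<union> Y) \<subseteq> X \<union> Y" using \<sigma>sides by auto
  ultimately have "bij_betw \<sigma> (X \<union> Y) (X \<union> Y)"
    by (simp add: bij_betw_def endo_inj_surj)
  moreover have "\<sigma> x = x" if "x \<notin> X \<union> Y" for x using that XY by (auto simp: \<sigma>_def)
  ultimately have "\<sigma> permutes X \<union> Y" by (rule bij_imp_permutes)
  then have aut: "\<sigma> \<in> automorphisms H" using \<sigma>sides by (rule automorphism_HI)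
  \<comment> \<open>A new node is switched iff a coefficient at one of its ends disagrees; then both
    are negated. For a zero coefficient no end disagrees.\<close>
  define T where "T = (S \<inter> (A \<union> B)) \<union>
    {N e |e. e \<in> F \<and> (\<exists>u\<in>e. b' $ {u, N e} \<noteq> sg S u * a' $ {\<tau> u, N (\<tau> ` e)})}"
  have TV: "sg T x = sg S x" if "x \<in> A \<union> B" for x using that N_notin by (auto simp: T_def sg_def)
  have TN: "N e \<in> T \<longleftrightarrow> (\<exists>u\<in>e. b' $ {u, N e} \<noteq> sg S u * a' $ {\<tau> u, N (\<tau> ` e)})" if "e \<in> F" for e
    using that N_notin[OF that] N_eq_iff[OF that] by (auto simp: T_def)
  have new: "b' $ {y, N e} = sg T y * sg T (N e) * a' $ {\<sigma> y, \<sigma> (N e)}" if e: "e \<in> F" and y: "y \<in> verts H" for e y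
  proof (cases "y \<in> e")
    case True
    then obtain z where z: "e = {y, z}" by (rule_tac FE[OF e]) auto
    have yz: "y \<in> A \<union> B" "z \<in> A \<union> B" "y \<noteq> z" using e unfolding z F_iff by auto
    let ?e' = "\<tau> ` e"
    have e': "?e' = {\<tau> y, \<tau> z}" "{\<tau> y, \<tau> z} \<in> F" using \<tau>F[OF e] by (simp_all add: z)
    have b: "b $ e = sg S y * sg S z * a $ ?e'"
      using \<tau>(2) yz by (simp add: signed_eq_def z)
    have sym: "e = {z, y}" "?e' = {\<tau> z, \<tau> y}" by (simp_all add: z insert_commute)
    have ab: "\<bar>a $ ?e'\<bar> = \<bar>b $ e\<bar>" by (simp add: b abs_mult)
    have "\<bar>b' $ {y, N e}\<bar> = \<bar>b $ e\<bar>" "\<bar>b' $ {z, N e}\<bar> = \<bar>b $ e\<bar>"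
      using elim_coeffsD(5)[OF c(2), of y z, folded z] elim_coeffsD(5)[OF c(2), of z y, folded sym(1)] e
      by blast+
    moreover have "\<bar>a' $ {\<tau> y, N ?e'}\<bar> = \<bar>b $ e\<bar>" "\<bar>a' $ {\<tau> z, N ?e'}\<bar> = \<bar>b $ e\<bar>"
      using elim_coeffsD(5)[OF c(1), of "\<tau> y" "\<tau> z", folded e'(1)]
        elim_coeffsD(5)[OF c(1), of "\<tau> z" "\<tau> y", folded sym(2)] \<tau>F[OF e]
      unfolding ab by blast+
    ultimately have abs: "\<bar>b' $ {y, N e}\<bar> = \<bar>b $ e\<bar>" "\<bar>b' $ {z, N e}\<bar> = \<bar>b $ e\<bar>"
      "\<bar>a' $ {\<tau> y, N ?e'}\<bar> = \<bar>b $ e\<bar>" "\<bar>a' $ {\<tau> z, N ?e'}\<bar> = \<bar>b $ e\<bar>" .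
    have "(sg S y * a' $ {\<tau> y, N ?e'}) * (sg S z * a' $ {\<tau> z, N ?e'}) =
        sg S y * sg S z * (a' $ {\<tau> y, N ?e'} * a' $ {\<tau> z, N ?e'})"
      by (simp only: ac_simps)
    also have "\<dots> = sg S y * sg S z * (- \<bar>a $ ?e'\<bar> * a $ ?e')"
      using elim_coeffsD(6)[OF c(1), of "\<tau> y" "\<tau> z", folded e'(1)] \<tau>F[OF e] by simp
    also have "\<dots> = - \<bar>b $ e\<bar> * (sg S y * sg S z * a $ ?e')"
      unfolding ab by (simp only: ac_simps)
    also have "\<dots> = b' $ {y, N e} * b' $ {z, N e}"
      using elim_coeffsD(6)[OF c(2), of y z, folded z] e b by simp
    finally have prod: "b' $ {y, N e} * b' $ {z, N e} =
        (sg S y * a' $ {\<tau> y, N ?e'}) * (sg S z * a' $ {\<tau> z, N ?e'})" by simp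
    \<comment> \<open>Two reals of equal given absolute value are determined by their product up to
      a common sign.\<close>
    have flip: "p = q \<and> r = s \<or> p = - q \<and> r = - s"
      if "\<bar>p\<bar> = t" "\<bar>q\<bar> = t" "\<bar>r\<bar> = t" "\<bar>s\<bar> = t" "p * r = q * s" for p q r s t :: real
      using that by (cases "t = 0") (auto simp: abs_if split: if_splits)
    have "b' $ {y, N e} = sg S y * a' $ {\<tau> y, N ?e'} \<and> b' $ {z, N e} = sg S z * a' $ {\<tau> z, N ?e'} \<or>
      b' $ {y, N e} = - (sg S y * a' $ {\<tau> y, N ?e'}) \<and> b' $ {z, N e} = - (sg S z * a' $ {\<tau> z, N ?e'})"
      by (rule flip[OF abs(1) _ abs(2) _ prod]) (simp_all add: abs_mult abs)
    then have "b' $ {y, N e} = sg S y * sg T (N e) * a' $ {\<tau> y, N ?e'}"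
      using TN[OF e] by (auto simp: z sg_def)
    then show ?thesis using TV yz(1) \<sigma>V[OF yz(1)] \<sigma>N[OF e] by simp
  next
    case False
    \<comment> \<open>Away from the ends of \<open>e\<close> both coefficients vanish, as
      \<open>\<sigma>\<close> sends new nodes to new nodes and is injective on old ones.\<close>
    have "\<sigma> y \<notin> \<tau> ` e"
    proof (cases "y \<in> A \<union> B")
      case True
      then show ?thesis using \<open>y \<notin> e\<close> inj \<sigma>V by auto
    next
      case nV: False
      then obtain f where f: "f \<in> F" "y = N f" using y by (auto simp: verts_H)
      then show ?thesis using \<sigma>N[OF f(1)] N_notin[OF \<tau>F[OF f(1)]] F_sub[OF \<tau>F[OF e]] by metis
    qed
    then show ?thesis using elim_coeffsD(7)[OF c(2) e False] elim_coeffsD(7)[OF c(1) \<tau>F[OF e]] \<sigma>N[OF e] by simp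
  qed
  have "b' $ {x, y} = sg T x * sg T y * a' $ {\<sigma> x, \<sigma> y}" if edge: "{x, y} \<in> edges H" for x y
  proof -
    have V: "x \<in> verts H" "y \<in> verts H" using pair_graph_edgeD[OF pair_graph_H edge] by auto
    then consider "x \<in> A \<union> B" "y \<in> A \<union> B" | e where "e \<in> F" "y = N e" | e where "e \<in> F" "x = N e"
      unfolding verts_H by blast
    then show ?thesis
    proof cases
      case 1
      then have *: "x \<in> A \<and> y \<in> B \<or> x \<in> B \<and> y \<in> A" using edge by (auto simp: edges_H old_sides)
      then have "\<tau> x \<in> A \<and> \<tau> y \<in> B \<or> \<tau> x \<in> B \<and> \<tau> y \<in> A" using sides by blast
      then have "a' $ {\<tau> x, \<tau> y} = a $ {\<tau> x, \<tau> y}" using elim_coeffsD(3,4)[OF c(1)] by blast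
      moreover have "b' $ {x, y} = b $ {x, y}" using * elim_coeffsD(3,4)[OF c(2)] by blast
      moreover have "b $ {x, y} = sg S x * sg S y * a $ {\<tau> x, \<tau> y}"
        using \<tau>(2) 1 * disj by (auto simp: signed_eq_def)
      ultimately show ?thesis using 1 TV \<sigma>V by simp
    next
      case 2
      then show ?thesis using new V by simp
    next
      case 3
      then show ?thesis using new[of e y] V by (simp add: insert_commute mult.commute)
    qed
  qed
  then have "signed_eq H \<sigma> T a' b'" by (simp add: signed_eq_def)
  then show ?thesis using aut by blast
qed

end

section \<open>The theorem\<close>

text \<open>Triples list the ends of an edge in a fixed order, whereas the forms are later indexed
  by the unordered edge.\<close>

lemma tri_forms_commute: "tri_forms u v w = tri_forms v u w"
proof -
  have "tri_minus u v w = tri_minus v u w" "tri_plus u v w = tri_plus v u w"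
    by (auto simp: tri_minus_def tri_plus_def insert_commute)
  moreover have "tri_minus w v u = tri_minus v w u" "tri_minus u w v = tri_minus w u v"
    by (auto simp: tri_minus_def insert_commute)
  ultimately show ?thesis unfolding tri_forms_def by auto
qed

lemma permutation_of_comp: "permutation_of (\<sigma> \<circ> \<tau>) I = permutation_of \<tau> (permutation_of \<sigma> I)"
  by (cases I) (simp add: permutation_of_def image_comp)

lemma sum_choose_two_cancel:
  assumes "p + (q choose 2) = q + (p choose 2)" "p + q \<ge> 5"
  shows "p = q"
proof -
  have two: "2 * int (n choose 2) = int n * (int n - 1)" for n
    by (induction n) (simp_all add: numeral_2_eq_2 algebra_simps)
  have "int p + int (q choose 2) = int q + int (p choose 2)" using assms(1) by linarith
  then have "2 * int p + int q * (int q - 1) = 2 * int q + int p * (int p - 1)"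
    using two[of p] two[of q] by linarith
  then have "(int p - int q) * (int p + int q - 3) = 0" by algebra
  then show ?thesis using assms(2) by auto
qed

context bipartite_elim
begin

text \<open>Each eliminated edge belongs to exactly one triple, so the sum over triples can be
  reindexed by edges.\<close>

lemma tri_elim_eliminates:
  assumes inj: "inj_on (\<lambda>(u, v, w). {u, v}) T" and im: "(\<lambda>(u, v, w). {u, v}) ` T = F"
    and N: "\<And>u v w. (u, v, w) \<in> T \<Longrightarrow> w = N {u, v}"
    and elim: "tri_elim KV T H (a, a0) (a', a0')"
  shows "eliminates (a, a0) (a', a0')"
proof -
  let ?g = "\<lambda>(u, v, w). {u, v}"
  obtain \<Delta> where \<Delta>: "\<And>u v w. (u, v, w) \<in> T \<Longrightarrow> \<Delta> (u, v, w) \<in> tri_forms u v w"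
    and eq: "\<And>x. a' \<bullet> x - a0' = a \<bullet> x - a0 + (\<Sum>(u, v, w)\<in>T. \<bar>a $ {u, v}\<bar> * \<Delta> (u, v, w) x)"
  proof -
    obtain \<Delta> where "\<forall>(u, v, w)\<in>T. \<Delta> (u, v, w) \<in> tri_forms u v w"
      and 1: "\<forall>x. a' \<bullet> x - a0' = a \<bullet> x - a0 + (\<Sum>(u, v, w)\<in>T. \<bar>a $ {u, v}\<bar> * \<Delta> (u, v, w) x)"
      using elim unfolding tri_elim_def prod.case by blast
    then have "\<Delta> (u, v, w) \<in> tri_forms u v w" if "(u, v, w) \<in> T" for u v w
      using that by blast
    then show thesis using 1 by (intro that[of \<Delta>]) blast+
  qed
  define D where "D e = \<Delta> (inv_into T ?g e)" for e
  have Dg: "D {u, v} = \<Delta> (u, v, w)" if "(u, v, w) \<in> T" for u v w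
    using inv_into_f_f[OF inj that] by (simp add: D_def)
  have "D {u, v} \<in> tri_forms u v (N {u, v})" if uv: "{u, v} \<in> F" for u v
  proof -
    have "{u, v} \<in> ?g ` T" using uv by (simp only: im)
    then obtain t where "{u, v} = ?g t" "t \<in> T" by (rule imageE)
    then obtain x y z where t: "(x, y, z) \<in> T" "{u, v} = {x, y}" by (cases t) simp
    have "z = N {u, v}" using N[OF t(1)] t(2) by simp
    moreover have "D {u, v} = \<Delta> (x, y, z)" unfolding t(2) by (rule Dg[OF t(1)])
    moreover have "u = x \<and> v = y \<or> u = y \<and> v = x" using t(2) by (auto simp: doubleton_eq_iff)
    then have "tri_forms u v z = tri_forms x y z" using tri_forms_commute by blast
    ultimately show ?thesis using \<Delta>[OF t(1)] by simp
  qed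
  moreover have "a' \<bullet> x - a0' = a \<bullet> x - a0 + (\<Sum>e\<in>F. \<bar>a $ e\<bar> * D e x)" for x
    unfolding eq im[symmetric] sum.reindex[OF inj]
    by (intro arg_cong2[where f = "(+)"] refl sum.cong) (auto simp: Dg)
  ultimately show ?thesis using elim unfolding eliminates_def tri_elim_def by blast
qed

lemma side_permutation_id: "side_permutation id"
  by (simp add: side_permutation_def permutes_id)

lemma side_permutation_comp:
  assumes "side_permutation \<sigma>" "side_permutation \<tau>"
  shows "side_permutation (\<sigma> \<circ> \<tau>)"
proof -
  have "\<sigma> \<circ> \<tau> permutes A \<union> B"
    using assms by (intro permutes_compose) (simp_all add: side_permutation_def)
  moreover from assms consider "\<tau> ` A = A" "\<tau> ` B = B" | "\<tau> ` A = B" "\<tau> ` B = A"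
    unfolding side_permutation_def by blast
  then have "(\<sigma> \<circ> \<tau>) ` A = A \<and> (\<sigma> \<circ> \<tau>) ` B = B \<or> (\<sigma> \<circ> \<tau>) ` A = B \<and> (\<sigma> \<circ> \<tau>) ` B = A"
    unfolding image_comp[symmetric]
  proof cases
    case 1
    show "\<sigma> ` \<tau> ` A = A \<and> \<sigma> ` \<tau> ` B = B \<or> \<sigma> ` \<tau> ` A = B \<and> \<sigma> ` \<tau> ` B = A"
      unfolding 1 using assms(1) by (simp add: side_permutation_def)
  next
    case 2
    show "\<sigma> ` \<tau> ` A = A \<and> \<sigma> ` \<tau> ` B = B \<or> \<sigma> ` \<tau> ` A = B \<and> \<sigma> ` \<tau> ` B = A"
      unfolding 2 using assms(1) unfolding side_permutation_def by blast
  qed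
  ultimately show ?thesis by (simp add: side_permutation_def)
qed

lemma side_permutation_automorphism: "side_permutation \<tau> \<Longrightarrow> \<tau> \<in> automorphisms KV"
proof -
  assume "side_permutation \<tau>"
  then have p: "\<tau> permutes A \<union> B" by (simp add: side_permutation_def)
  have "\<tau> u = \<tau> v \<longleftrightarrow> u = v" for u v using permutes_inj[OF p] by (metis injD)
  then show ?thesis
    unfolding automorphisms_def mem_Collect_eq complete_graph_simps permutes_in_image[OF p] using p by blast
qed

text \<open>Both sides are reduced to the existence of a signed relabelling, and these are
  translated between the graphs. The generators \<open>P\<close> stay abstract here, because the
  side swap is given in terms of labels.\<close>

lemma eliminations_equivalent_iff:
  assumes P: "P \<subseteq> {\<tau>. side_permutation \<tau>}" "\<And>\<sigma>. \<sigma> \<in> P \<Longrightarrow> inv \<sigma> \<in> P"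
    and gen: "\<And>\<tau> I. side_permutation \<tau> \<Longrightarrow> (ps_step KV P)\<^sup>*\<^sup>* I (permutation_of \<tau> I)"
    and card: "card X = card Y \<Longrightarrow> card A = card B"
    and elim: "eliminates (a, a0) (a', a0')" "eliminates (b, b0) (b', b0')"
    and tight: "tight KV (a, a0)" "tight KV (b, b0)"
    and deg: "large_degree a" "large_degree b"
  shows "transformable KV P (a, a0) (b, b0) \<longleftrightarrow> ps_equivalent H (a', a0') (b', b0')"
proof -
  note c = eliminates_coeffs[OF elim(1)] eliminates_coeffs[OF elim(2)]
  have "transformable KV P (a, a0) (b, b0) \<longleftrightarrow> (\<exists>\<tau>\<in>{\<tau>. side_permutation \<tau>}. \<exists>S. signed_eq KV \<tau> S a b)"
    by (rule transformable_iff_signed_eq[OF pair_graph_complete P(1) _ _ _ P(2) gen])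
      (auto intro: side_permutation_id side_permutation_comp side_permutation_automorphism
        elim_coeffsD(1)[OF c(1)] elim_coeffsD(1)[OF c(2)] tight)
  also have "\<dots> \<longleftrightarrow> (\<exists>\<sigma>\<in>automorphisms H. \<exists>T. signed_eq H \<sigma> T a' b')"
    using signed_eq_extend[OF c] signed_eq_restrict[OF c deg _ _ card] by blast
  also have "\<dots> \<longleftrightarrow> ps_equivalent H (a', a0') (b', b0')"
    by (rule ps_equivalent_iff_signed_eq[OF pair_graph_H elim_coeffsD(2)[OF c(1)] elim_coeffsD(2)[OF c(2)]
        eliminates_tight[OF elim(1) tight(1)] eliminates_tight[OF elim(2) tight(2)], symmetric])
  finally show ?thesis .
qed

end

section \<open>The labelled graphs as an instance of edge-indexed elimination\<close>

lemma complete_graph_ordered_edges: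
  fixes \<nu> :: "label \<Rightarrow> 'v::finite" and f :: "nat \<Rightarrow> label"
  assumes "inj_on \<nu> (f ` {1..n})" "inj f"
  shows "edges (complete_graph (\<nu> ` f ` {1..n})) =
    {{\<nu> (f i), \<nu> (f j)} |i j. 1 \<le> i \<and> i < j \<and> j \<le> n}" (is "?L = ?R")
proof
  have eq: "\<nu> (f i) = \<nu> (f j) \<longleftrightarrow> i = j" if "i \<in> {1..n}" "j \<in> {1..n}" for i j
    using assms that by (metis inj_onD imageI injD)
  show "?R \<subseteq> ?L" using eq by auto
  show "?L \<subseteq> ?R"
  proof
    fix e assume "e \<in> ?L"
    then obtain i j where ij: "i \<in> {1..n}" "j \<in> {1..n}" "i \<noteq> j" "e = {\<nu> (f i), \<nu> (f j)}"
      unfolding complete_graph_def snd_conv by blast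
    then consider "i < j" | "j < i" by linarith
    then show "e \<in> ?R"
    proof cases
      case 1
      then show ?thesis using ij by auto
    next
      case 2
      have "e = {\<nu> (f j), \<nu> (f i)}" using ij by (simp add: insert_commute)
      then show ?thesis using ij 2 by auto
    qed
  qed
qed

context
  fixes p q :: nat and \<nu> :: "label \<Rightarrow> 'v::finite"
  assumes inj: "inj_on \<nu> (A_side p q \<union> B_side p q)"
begin

text \<open>The third component of the unique triple over an eliminated edge; on other sets the
  value is arbitrary.\<close>

definition new_node :: "'v set \<Rightarrow> 'v" where
  "new_node e = snd (snd (inv_into (elim_triples \<nu> p q) (\<lambda>(u, v, w). {u, v}) e))"

lemma \<nu>_eq: "x \<in> A_side p q \<union> B_side p q \<Longrightarrow> y \<in> A_side p q \<union> B_side p q \<Longrightarrow> \<nu> x = \<nu> y \<longleftrightarrow> x = y"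
  using inj by (auto simp: inj_on_def)

lemma \<nu>_eq_A: "i \<in> {1..p} \<Longrightarrow> j \<in> {1..p} \<Longrightarrow> \<nu> (NA i) = \<nu> (NA j) \<longleftrightarrow> i = j"
  by (subst \<nu>_eq) (auto simp: A_side_def A_nodes_def)

lemma \<nu>_eq_B: "i \<in> {1..q} \<Longrightarrow> j \<in> {1..q} \<Longrightarrow> \<nu> (NB i) = \<nu> (NB j) \<longleftrightarrow> i = j"
  by (subst \<nu>_eq) (auto simp: B_side_def B_nodes_def)

lemma \<nu>_neq_AB: "i \<in> {1..p} \<Longrightarrow> j \<in> {1..q} \<Longrightarrow> \<nu> (NA i) \<noteq> \<nu> (NB j)"
  by (subst \<nu>_eq) (auto simp: A_side_def A_nodes_def B_side_def B_nodes_def)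

lemma triple_edges_inj: "inj_on (\<lambda>(u, v, w). {u, v}) (elim_triples \<nu> p q)"
proof (rule inj_onI)
  fix s t assume s: "s \<in> elim_triples \<nu> p q" and t: "t \<in> elim_triples \<nu> p q"
    and eq: "(\<lambda>(u, v, w). {u, v}) s = (\<lambda>(u, v, w). {u, v}) t"
  have cases: "(\<exists>i i'. s = (\<nu> (NA i), \<nu> (NA i'), \<nu> (NBB i i')) \<and> i \<in> {1..p} \<and> i' \<in> {1..p} \<and> i < i') \<or>
    (\<exists>i i'. s = (\<nu> (NB i), \<nu> (NB i'), \<nu> (NAA i i')) \<and> i \<in> {1..q} \<and> i' \<in> {1..q} \<and> i < i')"
    if "s \<in> elim_triples \<nu> p q" for s
    using that unfolding elim_triples_def by fastforce
  from cases[OF s] cases[OF t] show "s = t"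
  proof (elim disjE exE conjE, goal_cases)
    case (1 i j i' j')
    then have "{\<nu> (NA i), \<nu> (NA i')} = {\<nu> (NA j), \<nu> (NA j')}" using eq by simp
    then have "i = j \<and> i' = j' \<or> i = j' \<and> i' = j"
      using 1 \<nu>_eq_A by (simp add: doubleton_eq_iff)
    then show ?case using 1 by auto
  next
    case (2 i j i' j')
    then show ?case using eq \<nu>_neq_AB[of i j] \<nu>_neq_AB[of i j'] by (auto simp: doubleton_eq_iff)
  next
    case (3 i j i' j')
    then show ?case using eq \<nu>_neq_AB[of j i] \<nu>_neq_AB[of j i'] by (auto simp: doubleton_eq_iff)
  next
    case (4 i j i' j')
    then have "{\<nu> (NB i), \<nu> (NB i')} = {\<nu> (NB j), \<nu> (NB j')}" using eq by simp
    then have "i = j \<and> i' = j' \<or> i = j' \<and> i' = j"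
      using 4 \<nu>_eq_B by (simp add: doubleton_eq_iff)
    then show ?case using 4 by auto
  qed
qed

lemma new_node_triple: "(u, v, w) \<in> elim_triples \<nu> p q \<Longrightarrow> w = new_node {u, v}"
  using inv_into_f_f[OF triple_edges_inj, of "(u, v, w)"] by (simp add: new_node_def)

lemma edges_A: "edges (complete_graph (\<nu> ` A_nodes p)) =
    {{\<nu> (NA i), \<nu> (NA j)} |i j. 1 \<le> i \<and> i < j \<and> j \<le> p}"
  unfolding A_nodes_def by (rule complete_graph_ordered_edges)
    (auto intro: inj_on_subset[OF inj] simp: A_side_def A_nodes_def inj_def)

lemma edges_B: "edges (complete_graph (\<nu> ` B_nodes q)) =
    {{\<nu> (NB i), \<nu> (NB j)} |i j. 1 \<le> i \<and> i < j \<and> j \<le> q}"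
  unfolding B_nodes_def by (rule complete_graph_ordered_edges)
    (auto intro: inj_on_subset[OF inj] simp: B_side_def B_nodes_def inj_def)

lemma new_node_A: "1 \<le> i \<Longrightarrow> i < j \<Longrightarrow> j \<le> p \<Longrightarrow> new_node {\<nu> (NA i), \<nu> (NA j)} = \<nu> (NBB i j)"
  by (rule new_node_triple[symmetric]) (auto simp: elim_triples_def)

lemma new_node_B: "1 \<le> i \<Longrightarrow> i < j \<Longrightarrow> j \<le> q \<Longrightarrow> new_node {\<nu> (NB i), \<nu> (NB j)} = \<nu> (NAA i j)"
  by (rule new_node_triple[symmetric]) (auto simp: elim_triples_def)

lemma new_nodes_A: "new_node ` edges (complete_graph (\<nu> ` A_nodes p)) =
    \<nu> ` {NBB i i' |i i'. 1 \<le> i \<and> i < i' \<and> i' \<le> p}"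
proof
  show "new_node ` edges (complete_graph (\<nu> ` A_nodes p)) \<subseteq> \<nu> ` {NBB i i' |i i'. 1 \<le> i \<and> i < i' \<and> i' \<le> p}"
    unfolding edges_A by (auto simp: new_node_A)
  show "\<nu> ` {NBB i i' |i i'. 1 \<le> i \<and> i < i' \<and> i' \<le> p} \<subseteq> new_node ` edges (complete_graph (\<nu> ` A_nodes p))"
  proof
    fix w assume "w \<in> \<nu> ` {NBB i i' |i i'. 1 \<le> i \<and> i < i' \<and> i' \<le> p}"
    then obtain i j where ij: "w = \<nu> (NBB i j)" "1 \<le> i" "i < j" "j \<le> p" by blast
    then have "w = new_node {\<nu> (NA i), \<nu> (NA j)}" by (simp add: new_node_A)
    moreover have "{\<nu> (NA i), \<nu> (NA j)} \<in> edges (complete_graph (\<nu> ` A_nodes p))"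
      unfolding edges_A using ij by blast
    ultimately show "w \<in> new_node ` edges (complete_graph (\<nu> ` A_nodes p))" by blast
  qed
qed

lemma new_nodes_B: "new_node ` edges (complete_graph (\<nu> ` B_nodes q)) =
    \<nu> ` {NAA i i' |i i'. 1 \<le> i \<and> i < i' \<and> i' \<le> q}"
proof
  show "new_node ` edges (complete_graph (\<nu> ` B_nodes q)) \<subseteq> \<nu> ` {NAA i i' |i i'. 1 \<le> i \<and> i < i' \<and> i' \<le> q}"
    unfolding edges_B by (auto simp: new_node_B)
  show "\<nu> ` {NAA i i' |i i'. 1 \<le> i \<and> i < i' \<and> i' \<le> q} \<subseteq> new_node ` edges (complete_graph (\<nu> ` B_nodes q))"
  proof
    fix w assume "w \<in> \<nu> ` {NAA i i' |i i'. 1 \<le> i \<and> i < i' \<and> i' \<le> q}"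
    then obtain i j where ij: "w = \<nu> (NAA i j)" "1 \<le> i" "i < j" "j \<le> q" by blast
    then have "w = new_node {\<nu> (NB i), \<nu> (NB j)}" by (simp add: new_node_B)
    moreover have "{\<nu> (NB i), \<nu> (NB j)} \<in> edges (complete_graph (\<nu> ` B_nodes q))"
      unfolding edges_B using ij by blast
    ultimately show "w \<in> new_node ` edges (complete_graph (\<nu> ` B_nodes q))" by blast
  qed
qed

lemma triple_edges: "(\<lambda>(u, v, w). {u, v}) ` elim_triples \<nu> p q =
    edges (complete_graph (\<nu> ` A_nodes p)) \<union> edges (complete_graph (\<nu> ` B_nodes q))"
proof -
  have "(\<lambda>(u, v, w). {u, v}) ` {(f i j, g i j, h i j) |i j. P i j} = {{f i j, g i j} |i j. P i j}"
    for f g h :: "nat \<Rightarrow> nat \<Rightarrow> 'v" and P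
  proof -
    have "{(f i j, g i j, h i j) |i j. P i j} = (\<lambda>(i, j). (f i j, g i j, h i j)) ` {(i, j). P i j}"
      "{{f i j, g i j} |i j. P i j} = (\<lambda>(i, j). {f i j, g i j}) ` {(i, j). P i j}" by auto
    then show ?thesis by (simp add: image_image case_prod_unfold)
  qed
  then show ?thesis unfolding edges_A edges_B elim_triples_def image_Un by simp
qed

text \<open>Freshness and distinctness of the new nodes are inherited from the graph elimination by
  passing from an edge to its triple.\<close>

lemma bipartite_elim_Kbip: "bipartite_elim (\<nu> ` A_nodes p) (\<nu> ` B_nodes q) new_node"
proof
  show "\<nu> ` A_nodes p \<inter> \<nu> ` B_nodes q = {}"
    using \<nu>_neq_AB by (force simp: A_nodes_def B_nodes_def)
  note g = graph_tri_elim_Kbip[OF inj]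
  fix e assume "e \<in> edges (complete_graph (\<nu> ` A_nodes p)) \<union> edges (complete_graph (\<nu> ` B_nodes q))"
  then obtain u v w where "(u, v, w) \<in> elim_triples \<nu> p q" "e = {u, v}"
    unfolding triple_edges[symmetric] by auto
  then show "new_node e \<notin> \<nu> ` A_nodes p \<union> \<nu> ` B_nodes q"
    using g new_node_triple unfolding graph_tri_elim_def K_def by (fastforce simp: image_Un)
next
  show "inj_on new_node (edges (complete_graph (\<nu> ` A_nodes p)) \<union> edges (complete_graph (\<nu> ` B_nodes q)))"
  proof (rule inj_onI)
    fix e f assume "e \<in> edges (complete_graph (\<nu> ` A_nodes p)) \<union> edges (complete_graph (\<nu> ` B_nodes q))"
      "f \<in> edges (complete_graph (\<nu> ` A_nodes p)) \<union> edges (complete_graph (\<nu> ` B_nodes q))"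
      and eq: "new_node e = new_node f"
    then obtain u v w x y z where t: "(u, v, w) \<in> elim_triples \<nu> p q" "e = {u, v}"
      "(x, y, z) \<in> elim_triples \<nu> p q" "f = {x, y}"
      unfolding triple_edges[symmetric] by auto
    then have "w = z" using eq new_node_triple[OF t(1)] new_node_triple[OF t(3)] by simp
    moreover have i: "inj_on (\<lambda>(u, v, w). w) (elim_triples \<nu> p q)"
      using graph_tri_elim_Kbip[OF inj] by (simp add: graph_tri_elim_def)
    ultimately have "(u, v, w) = (x, y, z)" by (intro inj_onD[OF i _ t(1) t(3)]) simp
    then show "e = f" using t by simp
  qed
qed

interpretation E: bipartite_elim "\<nu> ` A_nodes p" "\<nu> ` B_nodes q" new_node
  by (rule bipartite_elim_Kbip)

lemma K_eq: "K \<nu> p q = E.KV"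
  by (simp add: K_def image_Un)

lemma X_eq: "E.X = \<nu> ` A_side p q"
  unfolding E.X_def new_nodes_B A_side_def by (simp add: image_Un)

lemma Y_eq: "E.Y = \<nu> ` B_side p q"
  unfolding E.Y_def new_nodes_A B_side_def by (simp add: image_Un)

lemma Kbip_eq: "Kbip \<nu> p q = E.H"
  by (simp add: Kbip_def X_eq Y_eq)

lemma card_AB: "card (\<nu> ` A_nodes p) = p" "card (\<nu> ` B_nodes q) = q"
proof -
  have "inj_on \<nu> (A_nodes p)" "inj_on \<nu> (B_nodes q)"
    by (auto intro: inj_on_subset[OF inj] simp: A_side_def B_side_def)
  moreover have "card (A_nodes p) = p" "card (B_nodes q) = q"
    by (simp_all add: card_image A_nodes_def B_nodes_def inj_on_def)
  ultimately show "card (\<nu> ` A_nodes p) = p" "card (\<nu> ` B_nodes q) = q"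
    by (simp_all only: card_image)
qed

lemma card_XY: "card E.X = p + (q choose 2)" "card E.Y = q + (p choose 2)"
proof -
  have "inj_on \<nu> (A_side p q)" "inj_on \<nu> (B_side p q)" by (auto intro: inj_on_subset[OF inj])
  then show "card E.X = p + (q choose 2)" "card E.Y = q + (p choose 2)"
    unfolding X_eq Y_eq by (simp_all add: card_image card_A_side card_B_side)
qed

section \<open>Generating all permutations that preserve or exchange the sides\<close>

definition swap_AB :: "'v \<Rightarrow> 'v" where
  "swap_AB x = (if x \<in> \<nu> ` (A_nodes p \<union> B_nodes q)
     then \<nu> (case inv_into (A_nodes p \<union> B_nodes q) \<nu> x of NA i \<Rightarrow> NB i | NB i \<Rightarrow> NA i | l \<Rightarrow> l)
     else x)"

lemma swap_AB_simps:
  assumes "i \<in> {1..p}" "p = q"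
  shows "swap_AB (\<nu> (NA i)) = \<nu> (NB i)" "swap_AB (\<nu> (NB i)) = \<nu> (NA i)"
proof -
  have "inj_on \<nu> (A_nodes p \<union> B_nodes q)"
    by (auto intro: inj_on_subset[OF inj] simp: A_side_def B_side_def)
  moreover have "NA i \<in> A_nodes p" "NB i \<in> B_nodes q" using assms by (auto simp: A_nodes_def B_nodes_def)
  ultimately show "swap_AB (\<nu> (NA i)) = \<nu> (NB i)" "swap_AB (\<nu> (NB i)) = \<nu> (NA i)"
    by (simp_all add: swap_AB_def)
qed

lemma AB_node_cases:
  assumes "x \<in> \<nu> ` (A_nodes p \<union> B_nodes q)" "p = q"
  obtains i where "i \<in> {1..p}" "x = \<nu> (NA i)" | i where "i \<in> {1..p}" "x = \<nu> (NB i)"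
  using assms unfolding A_nodes_def B_nodes_def by blast

lemma swap_AB_involution:
  assumes "p = q"
  shows "swap_AB (swap_AB x) = x"
proof (cases "x \<in> \<nu> ` (A_nodes p \<union> B_nodes q)")
  case True
  then show ?thesis using assms
    by (rule AB_node_cases) (simp_all only: swap_AB_simps[OF _ assms])
next
  case False
  then show ?thesis by (simp add: swap_AB_def)
qed

lemma swap_AB_permutes: "p = q \<Longrightarrow> swap_AB permutes \<nu> ` (A_nodes p \<union> B_nodes q)"
proof (rule bij_imp_permutes)
  assume pq: "p = q"
  have "swap_AB x \<in> \<nu> ` (A_nodes p \<union> B_nodes q)" if "x \<in> \<nu> ` (A_nodes p \<union> B_nodes q)" for x
    using that pq
  proof (rule AB_node_cases)
    fix i assume i: "i \<in> {1..p}"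
    then have "NA i \<in> A_nodes p" "NB i \<in> B_nodes q" using pq by (auto simp: A_nodes_def B_nodes_def)
    then show "x = \<nu> (NA i) \<Longrightarrow> ?thesis" "x = \<nu> (NB i) \<Longrightarrow> ?thesis"
      using swap_AB_simps[OF i pq] by auto
  qed
  then have "swap_AB ` \<nu> ` (A_nodes p \<union> B_nodes q) \<subseteq> \<nu> ` (A_nodes p \<union> B_nodes q)" by blast
  then show "bij_betw swap_AB (\<nu> ` (A_nodes p \<union> B_nodes q)) (\<nu> ` (A_nodes p \<union> B_nodes q))"
    using swap_AB_involution[OF pq] by (intro bij_betw_byWitness[of _ swap_AB]) auto
  show "swap_AB x = x" if "x \<notin> \<nu> ` (A_nodes p \<union> B_nodes q)" for x
    unfolding swap_AB_def using that by (rule if_not_P)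
qed

lemma swap_AB_mem: "p = q \<Longrightarrow> swap_AB \<in> AB_permutations \<nu> p q"
  using swap_AB_permutes swap_AB_simps by (simp add: AB_permutations_def)

lemma AB_permutations_side:
  assumes "\<sigma> \<in> AB_permutations \<nu> p q"
  shows "E.side_permutation \<sigma>"
proof -
  consider "\<sigma> permutes \<nu> ` A_nodes p" | "\<sigma> permutes \<nu> ` B_nodes q"
    | "p = q" "\<sigma> permutes \<nu> ` A_nodes p \<union> \<nu> ` B_nodes q"
      "\<And>i. i \<in> {1..p} \<Longrightarrow> \<sigma> (\<nu> (NA i)) = \<nu> (NB i) \<and> \<sigma> (\<nu> (NB i)) = \<nu> (NA i)"
    using assms unfolding AB_permutations_def image_Un by blast
  then show ?thesis
  proof cases
    case 1
    moreover have "\<sigma> ` \<nu> ` B_nodes q = id ` \<nu> ` B_nodes q"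
      by (rule image_cong[OF refl]) (use 1 E.disj permutes_not_in in force)
    ultimately show ?thesis unfolding E.side_permutation_def
      using permutes_image[OF 1] permutes_subset[OF 1] by simp
  next
    case 2
    moreover have "\<sigma> ` \<nu> ` A_nodes p = id ` \<nu> ` A_nodes p"
      by (rule image_cong[OF refl]) (use 2 E.disj permutes_not_in in force)
    ultimately show ?thesis unfolding E.side_permutation_def
      using permutes_image[OF 2] permutes_subset[OF 2] by simp
  next
    case 3
    have "\<sigma> ` \<nu> ` A_nodes p = \<nu> ` B_nodes q" "\<sigma> ` \<nu> ` B_nodes q = \<nu> ` A_nodes p"
      unfolding A_nodes_def B_nodes_def image_image using 3(1,3) by (auto intro!: image_cong)
    then show ?thesis using 3(2) by (simp add: E.side_permutation_def)
  qed
qed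

lemma AB_permutations_inv:
  assumes "\<sigma> \<in> AB_permutations \<nu> p q"
  shows "inv \<sigma> \<in> AB_permutations \<nu> p q"
proof -
  have "\<forall>i\<in>{1..p}. inv \<sigma> (\<nu> (NA i)) = \<nu> (NB i) \<and> inv \<sigma> (\<nu> (NB i)) = \<nu> (NA i)"
    if "\<sigma> permutes \<nu> ` (A_nodes p \<union> B_nodes q)"
      "\<forall>i\<in>{1..p}. \<sigma> (\<nu> (NA i)) = \<nu> (NB i) \<and> \<sigma> (\<nu> (NB i)) = \<nu> (NA i)"
    using that(2) permutes_inv_eq[OF that(1)] by auto
  then show ?thesis using assms permutes_inv unfolding AB_permutations_def by blast
qed

text \<open>A permutation preserving the sides is the product of its parts on the two sides. One
  exchanging them forces \<open>p = q\<close> and becomes side-preserving after composition with the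
  swap.\<close>

lemma side_permutation_generated:
  assumes "E.side_permutation \<tau>"
  shows "(ps_step E.KV (AB_permutations \<nu> p q))\<^sup>*\<^sup>* I (permutation_of \<tau> I)"
proof -
  let ?A = "\<nu> ` A_nodes p" and ?B = "\<nu> ` B_nodes q" and ?P = "AB_permutations \<nu> p q"
  have preserving: "(ps_step E.KV ?P)\<^sup>*\<^sup>* I (permutation_of \<tau> I)"
    if p: "\<tau> permutes ?A \<union> ?B" and im: "\<tau> ` ?A = ?A" "\<tau> ` ?B = ?B" for \<tau> I
  proof -
    define \<tau>A where "\<tau>A x = (if x \<in> ?A then \<tau> x else x)" for x
    define \<tau>B where "\<tau>B x = (if x \<in> ?B then \<tau> x else x)" for x
    have inj: "inj_on \<tau> Z" for Z using permutes_inj[OF p] inj_on_subset by blast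
    have "bij_betw \<tau>A ?A ?A" "bij_betw \<tau>B ?B ?B"
      using inj im by (auto simp: bij_betw_def \<tau>A_def \<tau>B_def inj_on_def)
    then have "\<tau>A permutes ?A" "\<tau>B permutes ?B"
      by (auto intro!: bij_imp_permutes simp: \<tau>A_def \<tau>B_def)
    then have mem: "\<tau>A \<in> ?P" "\<tau>B \<in> ?P" by (auto simp: AB_permutations_def)
    have "\<tau> x = \<tau>A (\<tau>B x)" for x
    proof -
      have "\<tau> x \<notin> ?A" if "x \<in> ?B" using that im(2) E.disj by blast
      moreover have "\<tau> x = x" if "x \<notin> ?A" "x \<notin> ?B" using that permutes_not_in[OF p] by blast
      ultimately show ?thesis using E.disj by (auto simp: \<tau>A_def \<tau>B_def)
    qed
    then have "\<tau> = \<tau>A \<circ> \<tau>B" by auto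
    then have "permutation_of \<tau> I = permutation_of \<tau>B (permutation_of \<tau>A I)"
      by (simp only: permutation_of_comp)
    then show ?thesis
      using ps_step.permute[OF mem(1), of E.KV I] ps_step.permute[OF mem(2), of E.KV "permutation_of \<tau>A I"]
      by (metis converse_rtranclp_into_rtranclp r_into_rtranclp)
  qed
  show ?thesis
  proof (cases "\<tau> ` ?A = ?A \<and> \<tau> ` ?B = ?B")
    case True
    then show ?thesis using assms preserving by (simp add: E.side_permutation_def)
  next
    case False
    then have \<tau>: "\<tau> permutes ?A \<union> ?B" "\<tau> ` ?A = ?B" "\<tau> ` ?B = ?A"
      using assms by (auto simp: E.side_permutation_def)
    have "card (\<tau> ` ?A) = card ?A" by (intro card_image inj_on_subset[OF permutes_inj[OF \<tau>(1)]]) simp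
    then have pq: "p = q" using card_AB \<tau>(2) by simp
    have sw: "swap_AB permutes ?A \<union> ?B" using swap_AB_permutes[OF pq] by (simp add: image_Un)
    have swim: "swap_AB ` ?A = ?B" "swap_AB ` ?B = ?A"
      unfolding A_nodes_def B_nodes_def image_image using pq swap_AB_simps by (auto intro!: image_cong)
    \<comment> \<open>Relabelling reverses the order of composition: the swap is applied to
      \<open>I\<close> before the side-preserving factor. The two swaps then cancel and leave
      \<open>\<tau>\<close>.\<close>
    have "(ps_step E.KV ?P)\<^sup>*\<^sup>* (permutation_of swap_AB I)
        (permutation_of (swap_AB \<circ> \<tau>) (permutation_of swap_AB I))"
      using permutes_compose[OF \<tau>(1) sw]
      by (rule preserving) (simp_all only: image_comp[symmetric] \<tau>(2,3) swim)
    moreover have "swap_AB \<circ> (swap_AB \<circ> \<tau>) = \<tau>" using swap_AB_involution[OF pq] by auto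
    then have "permutation_of (swap_AB \<circ> \<tau>) (permutation_of swap_AB I) = permutation_of \<tau> I"
      by (metis permutation_of_comp)
    ultimately show ?thesis
      using ps_step.permute[OF swap_AB_mem[OF pq], of E.KV I]
      by (metis converse_rtranclp_into_rtranclp)
  qed
qed

lemma facet_inducing_large_degree:
  assumes "p + q \<ge> 5" "facet_inducing (K \<nu> p q) (a, a0)" "\<not> triangle_inequality (K \<nu> p q) (a, a0)"
  shows "E.large_degree a"
proof -
  have "card (\<nu> ` A_nodes p \<union> \<nu> ` B_nodes q) = p + q"
    using card_AB E.disj by (simp add: card_Un_disjoint)
  then show ?thesis
    using facet_inducing_degree[OF assms(2,3)[unfolded K_eq]] assms(1)
    unfolding E.large_degree_def by auto
qed

lemma transformable_iff_ps_equivalent_Kbip: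
  assumes n: "p + q \<ge> 5"
    and a: "facet_inducing (K \<nu> p q) (a, a0)" "\<not> triangle_inequality (K \<nu> p q) (a, a0)"
    and b: "facet_inducing (K \<nu> p q) (b, b0)" "\<not> triangle_inequality (K \<nu> p q) (b, b0)"
    and elim: "tri_elim (K \<nu> p q) (elim_triples \<nu> p q) (Kbip \<nu> p q) (a, a0) (a', a0')"
      "tri_elim (K \<nu> p q) (elim_triples \<nu> p q) (Kbip \<nu> p q) (b, b0) (b', b0')"
  shows "transformable (K \<nu> p q) (AB_permutations \<nu> p q) (a, a0) (b, b0) \<longleftrightarrow>
    ps_equivalent (Kbip \<nu> p q) (a', a0') (b', b0')"
  unfolding K_eq Kbip_eq
proof (rule E.eliminations_equivalent_iff)
  show "AB_permutations \<nu> p q \<subseteq> {\<tau>. E.side_permutation \<tau>}" using AB_permutations_side by blast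
  show "inv \<sigma> \<in> AB_permutations \<nu> p q" if "\<sigma> \<in> AB_permutations \<nu> p q" for \<sigma>
    using that by (rule AB_permutations_inv)
  show "(ps_step E.KV (AB_permutations \<nu> p q))\<^sup>*\<^sup>* I (permutation_of \<tau> I)" if "E.side_permutation \<tau>" for \<tau> I
    using that by (rule side_permutation_generated)
  show "card (\<nu> ` A_nodes p) = card (\<nu> ` B_nodes q)" if "card E.X = card E.Y"
    using sum_choose_two_cancel[OF that[unfolded card_XY] n] unfolding card_AB .
  note eliminates = E.tri_elim_eliminates[OF triple_edges_inj triple_edges[folded E.F_def] new_node_triple]
  show "E.eliminates (a, a0) (a', a0')" by (rule eliminates[OF _ elim(1)[unfolded K_eq Kbip_eq]])
  show "E.eliminates (b, b0) (b', b0')" by (rule eliminates[OF _ elim(2)[unfolded K_eq Kbip_eq]])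
  show "tight E.KV (a, a0)" "tight E.KV (b, b0)"
    using facet_inducing_tight[OF a(1)[unfolded K_eq]] facet_inducing_tight[OF b(1)[unfolded K_eq]] .
  show "E.large_degree a" "E.large_degree b"
    using facet_inducing_large_degree[OF n a] facet_inducing_large_degree[OF n b] .
qed

end

theorem theorem4p5:
  fixes p q n :: nat
    and \<nu> :: "label \<Rightarrow> 'v::finite"
    and a b a' b' :: "'v evec"
    and a0 b0 a0' b0' :: real
  assumes "n = p + q" and "n \<ge> 5"
    and "inj_on \<nu> (A_side p q \<union> B_side p q)"
    and "facet_inducing (K \<nu> p q) (a, a0)" and "\<not> triangle_inequality (K \<nu> p q) (a, a0)"
    and "facet_inducing (K \<nu> p q) (b, b0)" and "\<not> triangle_inequality (K \<nu> p q) (b, b0)"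
    and "tri_elim (K \<nu> p q) (elim_triples \<nu> p q) (Kbip \<nu> p q) (a, a0) (a', a0')"
    and "tri_elim (K \<nu> p q) (elim_triples \<nu> p q) (Kbip \<nu> p q) (b, b0) (b', b0')"
  shows "transformable (K \<nu> p q) (AB_permutations \<nu> p q) (a, a0) (b, b0) \<longleftrightarrow>
    ps_equivalent (Kbip \<nu> p q) (a', a0') (b', b0')"
  using assms by (intro transformable_iff_ps_equivalent_Kbip) auto

end
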